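(* There is a polynomial-time algorithm which, given a polynomial $P(X)=\sum_{i=0}^m A_iX^i$ whose coefficients are permutations and which is injective on permutations, and given a permutation $B$, decides whether there exists a permutation $X$ with $P(X)=B$ and, if so, outputs it.
   Context: An FDDS is a finite set with a total function on it, viewed as a functional digraph up to isomorphism. Sum is disjoint union and product is the direct product of digraphs (vertex set $V(A)\times V(B)$, arc $(u,u')\to(v,v')$ iff $u\to v$ and $u'\to v'$); $X^0$ is the single fixed point. A permutation is an FDDS consisting only of cycles. $P$ is injective on permutations if $P(X)=P(Y)$ for permutations $X,Y$ implies $X=Y$. Inputs are given as explicit graphs, and polynomial time is with respect to the total size (number of states) of the coefficients of $P$ and of $B$. *)

theory Defs
  imports
    "HOL-Library.Nat_Bijection"
    "HOL-Computational_Algebra.Polynomial"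
begin

section \<open>Finite discrete dynamical systems\<close>

text \<open>A pair \<open>(V, f)\<close> stands for the functional digraph on \<open>V\<close> with arcs \<open>u \<rightarrow> f u\<close>.\<close>

type_synonym 'a fun_graph = "'a set \<times> ('a \<Rightarrow> 'a)"

definition is_fdds :: "'a fun_graph \<Rightarrow> bool" where
  "is_fdds A \<longleftrightarrow> finite (fst A) \<and> (\<forall>u\<in>fst A. snd A u \<in> fst A)"

definition isom :: "'a fun_graph \<Rightarrow> 'b fun_graph \<Rightarrow> bool" where
  "isom A B \<longleftrightarrow> (\<exists>h. bij_betw h (fst A) (fst B) \<and> (\<forall>u\<in>fst A. h (snd A u) = snd B (h u)))"

definition disjoint_union :: "'a fun_graph \<Rightarrow> 'b fun_graph \<Rightarrow> ('a + 'b) fun_graph" where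
  "disjoint_union A B = (fst A <+> fst B, map_sum (snd A) (snd B))"

definition direct_product :: "'a fun_graph \<Rightarrow> 'b fun_graph \<Rightarrow> ('a \<times> 'b) fun_graph" where
  "direct_product A B = (fst A \<times> fst B, map_prod (snd A) (snd B))"

text \<open>Every state lies on a cycle.\<close>

definition only_cycles :: "'a fun_graph \<Rightarrow> bool" where
  "only_cycles A \<longleftrightarrow> (\<forall>u\<in>fst A. \<exists>k>0. (snd A ^^ k) u = u)"

definition relabel :: "('a \<Rightarrow> 'b) \<Rightarrow> 'a fun_graph \<Rightarrow> 'b fun_graph" where
  "relabel h A = (h ` fst A, h \<circ> snd A \<circ> inv h)"

lemma isomI:
  assumes "\<And>u. u \<in> fst A \<Longrightarrow> h u \<in> fst B \<and> g (h u) = u \<and> h (snd A u) = snd B (h u)"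
    and "\<And>v. v \<in> fst B \<Longrightarrow> g v \<in> fst A \<and> h (g v) = v"
  shows "isom A B"
proof -
  have "bij_betw h (fst A) (fst B)"
    by (rule bij_betw_byWitness[where f' = g]) (use assms in auto)
  then show ?thesis unfolding isom_def using assms(1) by blast
qed

lemma isom_refl: "isom A A"
  unfolding isom_def by (rule exI[of _ id]) auto

lemma isom_sym: "is_fdds A \<Longrightarrow> isom A B \<Longrightarrow> isom B A"
  unfolding isom_def
proof (elim exE conjE)
  fix h assume fd: "is_fdds A" and b: "bij_betw h (fst A) (fst B)"
    and c: "\<forall>u\<in>fst A. h (snd A u) = snd B (h u)"
  let ?g = "inv_into (fst A) h"
  have "?g (snd B v) = snd A (?g v)" if "v \<in> fst B" for v
  proof -
    have gv: "?g v \<in> fst A" "h (?g v) = v"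
      using b that by (auto simp: bij_betw_def inv_into_into f_inv_into_f)
    have "snd B v = h (snd A (?g v))" using c gv by metis
    then show ?thesis
      using fd gv b by (auto simp: is_fdds_def bij_betw_def)
  qed
  then show "\<exists>h. bij_betw h (fst B) (fst A) \<and> (\<forall>u\<in>fst B. h (snd B u) = snd A (h u))"
    using b bij_betw_inv_into by blast
qed

lemma isom_trans: "isom A B \<Longrightarrow> isom B C \<Longrightarrow> isom A C"
  unfolding isom_def
proof (elim exE conjE)
  fix h g
  assume 1: "bij_betw h (fst A) (fst B)" "\<forall>u\<in>fst A. h (snd A u) = snd B (h u)"
    and 2: "bij_betw g (fst B) (fst C)" "\<forall>u\<in>fst B. g (snd B u) = snd C (g u)"
  have "\<forall>u\<in>fst A. h u \<in> fst B" using 1(1) by (auto simp: bij_betw_def)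
  with 1 2 show "\<exists>h. bij_betw h (fst A) (fst C) \<and> (\<forall>u\<in>fst A. h (snd A u) = snd C (h u))"
    by (intro exI[of _ "g \<circ> h"]) (auto intro: bij_betw_trans)
qed

lemma isom_transfer: "is_fdds A \<Longrightarrow> isom A A' \<Longrightarrow> isom A B \<Longrightarrow> isom B B' \<Longrightarrow> isom A' B'"
  using isom_sym isom_trans by metis

lemma is_fdds_isom:
  assumes "is_fdds A" "isom A B"
  shows "is_fdds B"
proof -
  obtain h where h: "bij_betw h (fst A) (fst B)" "\<forall>u\<in>fst A. h (snd A u) = snd B (h u)"
    using assms(2) unfolding isom_def by blast
  have B: "fst B = h ` fst A" using h(1) by (simp add: bij_betw_def)
  have "snd B (h u) \<in> h ` fst A" if "u \<in> fst A" for u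
  proof -
    have "snd B (h u) = h (snd A u)" using h(2) that by simp
    then show ?thesis using assms(1) that by (simp add: is_fdds_def)
  qed
  then show ?thesis using assms(1) unfolding is_fdds_def B by blast
qed

lemma isom_relabel:
  assumes "inj h"
  shows "isom A (relabel h A)"
  unfolding isom_def relabel_def
  using assms by (intro exI[of _ h]) (auto simp: bij_betw_def intro: inj_on_subset)

lemma is_fdds_relabel: "inj h \<Longrightarrow> is_fdds A \<Longrightarrow> is_fdds (relabel h A)"
  using is_fdds_isom isom_relabel by blast

lemma is_fdds_disjoint_union:
  "is_fdds A \<Longrightarrow> is_fdds B \<Longrightarrow> is_fdds (disjoint_union A B)"
  by (auto simp: is_fdds_def disjoint_union_def)

lemma is_fdds_direct_product:
  "is_fdds A \<Longrightarrow> is_fdds B \<Longrightarrow> is_fdds (direct_product A B)"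
  by (auto simp: is_fdds_def direct_product_def)

lemma isom_disjoint_union:
  assumes "isom A A'" "isom B B'"
  shows "isom (disjoint_union A B) (disjoint_union A' B')"
proof -
  obtain h g where
    1: "bij_betw h (fst A) (fst A')" "\<forall>u\<in>fst A. h (snd A u) = snd A' (h u)" and
    2: "bij_betw g (fst B) (fst B')" "\<forall>u\<in>fst B. g (snd B u) = snd B' (g u)"
    using assms unfolding isom_def by blast
  have "map_sum h g ` (fst A <+> fst B) = Inl ` (h ` fst A) \<union> Inr ` (g ` fst B)"
    by (simp add: Plus_def image_Un image_image)
  then have "map_sum h g ` (fst A <+> fst B) = fst A' <+> fst B'"
    using 1(1) 2(1) by (simp add: bij_betw_def Plus_def)
  moreover have "inj_on (map_sum h g) (fst A <+> fst B)"
    using bij_betw_imp_inj_on[OF 1(1)] bij_betw_imp_inj_on[OF 2(1)]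
    by (intro inj_onI) (elim PlusE; auto dest: inj_onD)
  ultimately show ?thesis
    unfolding isom_def disjoint_union_def using 1(2) 2(2)
    by (intro exI[of _ "map_sum h g"]) (auto simp: bij_betw_def)
qed

lemma isom_direct_product:
  assumes "isom A A'" "isom B B'"
  shows "isom (direct_product A B) (direct_product A' B')"
proof -
  obtain h g where
    1: "bij_betw h (fst A) (fst A')" "\<forall>u\<in>fst A. h (snd A u) = snd A' (h u)" and
    2: "bij_betw g (fst B) (fst B')" "\<forall>u\<in>fst B. g (snd B u) = snd B' (g u)"
    using assms unfolding isom_def by blast
  have "bij_betw (map_prod h g) (fst A \<times> fst B) (fst A' \<times> fst B')"
    using 1(1) 2(1) by (rule bij_betw_map_prod)
  then show ?thesis
    unfolding isom_def direct_product_def using 1(2) 2(2)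
    by (intro exI[of _ "map_prod h g"]) auto
qed

lemma isom_funpow:
  assumes "is_fdds A" "\<forall>u\<in>fst A. h (snd A u) = snd B (h u)" "u \<in> fst A"
  shows "(snd A ^^ k) u \<in> fst A \<and> h ((snd A ^^ k) u) = (snd B ^^ k) (h u)"
  using assms by (induction k) (auto simp: is_fdds_def)

lemma only_cycles_isom:
  assumes "is_fdds A" "isom A B" "only_cycles A"
  shows "only_cycles B"
proof -
  obtain h where h: "bij_betw h (fst A) (fst B)" "\<forall>u\<in>fst A. h (snd A u) = snd B (h u)"
    using assms(2) unfolding isom_def by blast
  have "\<exists>k>0. (snd B ^^ k) v = v" if "v \<in> fst B" for v
  proof -
    obtain u where u: "u \<in> fst A" "v = h u" using h(1) \<open>v \<in> fst B\<close> by (auto simp: bij_betw_def)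
    then obtain k where "k > 0" "(snd A ^^ k) u = u" using assms(3) by (auto simp: only_cycles_def)
    then show ?thesis using isom_funpow[OF assms(1) h(2) u(1), of k] u(2) by auto
  qed
  then show ?thesis by (auto simp: only_cycles_def)
qed

section \<open>The semiring of FDDS up to isomorphism\<close>

text \<open>
  Up to isomorphism every finite system has states in \<open>nat\<close>; \<open>sum_encode\<close> and \<open>prod_encode\<close>
  only serve to move disjoint unions and direct products back to that state type.
\<close>

quotient_type fdds = "nat fun_graph" / partial: "\<lambda>A B. is_fdds A \<and> is_fdds B \<and> isom A B"
  morphisms rep_fdds abs_fdds
proof (rule part_equivpI)
  show "\<exists>A::nat fun_graph. is_fdds A \<and> is_fdds A \<and> isom A A"
    by (rule exI[of _ "({}, id)"]) (simp add: is_fdds_def isom_refl)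
  show "symp (\<lambda>A B :: nat fun_graph. is_fdds A \<and> is_fdds B \<and> isom A B)"
    by (rule sympI) (simp add: isom_sym)
  show "transp (\<lambda>A B :: nat fun_graph. is_fdds A \<and> is_fdds B \<and> isom A B)"
    by (rule transpI) (metis isom_trans)
qed

lemma isom_relabel2:
  assumes "inj h" "inj g" "is_fdds A" "isom A B"
  shows "isom (relabel h A) (relabel g B)"
  by (rule isom_transfer[OF assms(3) isom_relabel[OF assms(1)] assms(4) isom_relabel[OF assms(2)]])

instantiation fdds :: comm_semiring_1
begin

lift_definition zero_fdds :: fdds is "({}, id)"
  by (simp add: is_fdds_def isom_refl)

lift_definition one_fdds :: fdds is "({0}, id)"
  by (simp add: is_fdds_def isom_refl)

lift_definition plus_fdds :: "fdds \<Rightarrow> fdds \<Rightarrow> fdds" is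
  "\<lambda>A B. relabel sum_encode (disjoint_union A B)"
  by (auto intro!: is_fdds_relabel isom_relabel2 is_fdds_disjoint_union isom_disjoint_union
      simp: inj_sum_encode)

lift_definition times_fdds :: "fdds \<Rightarrow> fdds \<Rightarrow> fdds" is
  "\<lambda>A B. relabel prod_encode (direct_product A B)"
  by (auto intro!: is_fdds_relabel isom_relabel2 is_fdds_direct_product isom_direct_product
      simp: inj_prod_encode)

instance
proof
  note intros = is_fdds_relabel is_fdds_disjoint_union is_fdds_direct_product
    inj_sum_encode inj_prod_encode
  have S: "isom (disjoint_union A B) (relabel sum_encode (disjoint_union A B))"
    for A B :: "nat fun_graph"
    by (rule isom_relabel[OF inj_sum_encode])
  have T: "isom (direct_product A B) (relabel prod_encode (direct_product A B))"
    for A B :: "nat fun_graph"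
    by (rule isom_relabel[OF inj_prod_encode])
  have empty: "is_fdds ({} :: nat set, id)" and single: "is_fdds ({0::nat}, id)"
    by (simp_all add: is_fdds_def)
  fix a b c :: fdds
  show "a + b + c = a + (b + c)"
  proof (transfer, elim conjE, intro conjI)
    fix A B C :: "nat fun_graph"
    assume fd: "is_fdds A" "is_fdds B" "is_fdds C"
    have core: "isom (disjoint_union (disjoint_union A B) C) (disjoint_union A (disjoint_union B C))"
      by (rule isomI[where h = "case_sum (case_sum Inl (Inr \<circ> Inl)) (Inr \<circ> Inr)"
            and g = "case_sum (Inl \<circ> Inl) (case_sum (Inl \<circ> Inr) Inr)"])
        (auto simp: disjoint_union_def)
    have 1: "isom (disjoint_union (disjoint_union A B) C)
        (relabel sum_encode (disjoint_union (relabel sum_encode (disjoint_union A B)) C))"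
      by (rule isom_trans[OF isom_disjoint_union[OF S isom_refl] S])
    have 2: "isom (disjoint_union A (disjoint_union B C))
        (relabel sum_encode (disjoint_union A (relabel sum_encode (disjoint_union B C))))"
      by (rule isom_trans[OF isom_disjoint_union[OF isom_refl S] S])
    show "isom (relabel sum_encode (disjoint_union (relabel sum_encode (disjoint_union A B)) C))
        (relabel sum_encode (disjoint_union A (relabel sum_encode (disjoint_union B C))))"
      by (rule isom_transfer[OF _ 1 core 2]) (intro intros fd)
  qed (auto intro!: intros)
  show "a + b = b + a"
  proof (transfer, elim conjE, intro conjI)
    fix A B :: "nat fun_graph"
    assume fd: "is_fdds A" "is_fdds B"
    have core: "isom (disjoint_union A B) (disjoint_union B A)"
      by (rule isomI[where h = "case_sum Inr Inl" and g = "case_sum Inr Inl"])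
        (auto simp: disjoint_union_def)
    show "isom (relabel sum_encode (disjoint_union A B)) (relabel sum_encode (disjoint_union B A))"
      by (rule isom_transfer[OF _ S core S]) (intro intros fd)
  qed (auto intro!: intros)
  show "0 + a = a"
  proof (transfer, elim conjE, intro conjI)
    fix A :: "nat fun_graph"
    assume fd: "is_fdds A"
    let ?E = "({} :: nat set, id :: nat \<Rightarrow> nat)"
    have core: "isom A (disjoint_union ?E A)"
      by (rule isomI[where h = Inr and g = projr])
        (auto simp: disjoint_union_def)
    have "isom A (relabel sum_encode (disjoint_union ?E A))"
      by (rule isom_trans[OF core S])
    then show "isom (relabel sum_encode (disjoint_union ?E A)) A"
      by (rule isom_sym[OF fd])
  qed (auto intro!: intros empty)
  show "a * b * c = a * (b * c)"
  proof (transfer, elim conjE, intro conjI)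
    fix A B C :: "nat fun_graph"
    assume fd: "is_fdds A" "is_fdds B" "is_fdds C"
    have core: "isom (direct_product (direct_product A B) C) (direct_product A (direct_product B C))"
      by (rule isomI[where h = "\<lambda>((x, y), z). (x, (y, z))" and g = "\<lambda>(x, (y, z)). ((x, y), z)"])
        (auto simp: direct_product_def)
    have 1: "isom (direct_product (direct_product A B) C)
        (relabel prod_encode (direct_product (relabel prod_encode (direct_product A B)) C))"
      by (rule isom_trans[OF isom_direct_product[OF T isom_refl] T])
    have 2: "isom (direct_product A (direct_product B C))
        (relabel prod_encode (direct_product A (relabel prod_encode (direct_product B C))))"
      by (rule isom_trans[OF isom_direct_product[OF isom_refl T] T])
    show "isom (relabel prod_encode (direct_product (relabel prod_encode (direct_product A B)) C))
        (relabel prod_encode (direct_product A (relabel prod_encode (direct_product B C))))"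
      by (rule isom_transfer[OF _ 1 core 2]) (intro intros fd)
  qed (auto intro!: intros)
  show "a * b = b * a"
  proof (transfer, elim conjE, intro conjI)
    fix A B :: "nat fun_graph"
    assume fd: "is_fdds A" "is_fdds B"
    have core: "isom (direct_product A B) (direct_product B A)"
      by (rule isomI[where h = prod.swap and g = prod.swap])
        (auto simp: direct_product_def)
    show "isom (relabel prod_encode (direct_product A B)) (relabel prod_encode (direct_product B A))"
      by (rule isom_transfer[OF _ T core T]) (intro intros fd)
  qed (auto intro!: intros)
  show "1 * a = a"
  proof (transfer, elim conjE, intro conjI)
    fix A :: "nat fun_graph"
    assume fd: "is_fdds A"
    let ?E = "({0} :: nat set, id :: nat \<Rightarrow> nat)"
    have core: "isom A (direct_product ?E A)"
      by (rule isomI[where h = "Pair 0" and g = snd])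
        (auto simp: direct_product_def)
    have "isom A (relabel prod_encode (direct_product ?E A))"
      by (rule isom_trans[OF core T])
    then show "isom (relabel prod_encode (direct_product ?E A)) A"
      by (rule isom_sym[OF fd])
  qed (auto intro!: intros single)
  show "(a + b) * c = a * c + b * c"
  proof (transfer, elim conjE, intro conjI)
    fix A B C :: "nat fun_graph"
    assume fd: "is_fdds A" "is_fdds B" "is_fdds C"
    have core: "isom (direct_product (disjoint_union A B) C)
        (disjoint_union (direct_product A C) (direct_product B C))"
      by (rule isomI[where h = "\<lambda>(x, z). case_sum (\<lambda>y. Inl (y, z)) (\<lambda>y. Inr (y, z)) x"
            and g = "case_sum (\<lambda>(y, z). (Inl y, z)) (\<lambda>(y, z). (Inr y, z))"])
        (auto simp: direct_product_def disjoint_union_def)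
    have 1: "isom (direct_product (disjoint_union A B) C)
        (relabel prod_encode (direct_product (relabel sum_encode (disjoint_union A B)) C))"
      by (rule isom_trans[OF isom_direct_product[OF S isom_refl] T])
    have 2: "isom (disjoint_union (direct_product A C) (direct_product B C))
        (relabel sum_encode (disjoint_union (relabel prod_encode (direct_product A C))
          (relabel prod_encode (direct_product B C))))"
      by (rule isom_trans[OF isom_disjoint_union[OF T T] S])
    show "isom (relabel prod_encode (direct_product (relabel sum_encode (disjoint_union A B)) C))
        (relabel sum_encode (disjoint_union (relabel prod_encode (direct_product A C))
          (relabel prod_encode (direct_product B C))))"
      by (rule isom_transfer[OF _ 1 core 2]) (intro intros fd)
  qed (auto intro!: intros)
  show "0 * a = 0"
    by transfer (auto simp: relabel_def direct_product_def is_fdds_def isom_def)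
  show "a * 0 = 0"
    by transfer (auto simp: relabel_def direct_product_def is_fdds_def isom_def)
  show "(0::fdds) \<noteq> 1"
    by transfer (auto simp: isom_def bij_betw_def)
qed

end

lift_definition num_states :: "fdds \<Rightarrow> nat" is "\<lambda>A. card (fst A)"
  by (auto simp: isom_def bij_betw_same_card)

lift_definition is_perm :: "fdds \<Rightarrow> bool" is only_cycles
  by (metis isom_sym only_cycles_isom)

section \<open>A random access machine\<close>

text \<open>
  Random access machines as structured programs. The store consists of named arrays of
  natural numbers with unboundedly many cells. Each node of an expression and each command
  costs one time unit. The only arithmetic is addition and truncated subtraction, so that every
  step makes the longest word grow by at most one bit; without multiplication the unit cost
  measure is polynomially equivalent to Turing machine time.
\<close>

type_synonym store = "string \<Rightarrow> nat \<Rightarrow> nat"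

datatype expr = Const nat | Read string expr | Add expr expr | Sub expr expr

primrec expr_val :: "expr \<Rightarrow> store \<Rightarrow> nat" where
  "expr_val (Const n) s = n"
| "expr_val (Read a e) s = s a (expr_val e s)"
| "expr_val (Add e1 e2) s = expr_val e1 s + expr_val e2 s"
| "expr_val (Sub e1 e2) s = expr_val e1 s - expr_val e2 s"

primrec expr_cost :: "expr \<Rightarrow> nat" where
  "expr_cost (Const n) = 1"
| "expr_cost (Read a e) = 1 + expr_cost e"
| "expr_cost (Add e1 e2) = 1 + expr_cost e1 + expr_cost e2"
| "expr_cost (Sub e1 e2) = 1 + expr_cost e1 + expr_cost e2"

datatype program =
    Skip
  | Write string expr expr
  | Seq program program
  | Cond expr program program
  | While expr program

text \<open>\<open>exec c s t s'\<close>: started in \<open>s\<close>, program \<open>c\<close> halts in \<open>s'\<close> after exactly \<open>t\<close> steps.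
  Guards are true when their value is nonzero.\<close>

inductive exec :: "program \<Rightarrow> store \<Rightarrow> nat \<Rightarrow> store \<Rightarrow> bool" where
  Skip: "exec Skip s 1 s"
| Write: "exec (Write a i e) s (1 + expr_cost i + expr_cost e)
    (s(a := (s a)(expr_val i s := expr_val e s)))"
| Seq: "exec c1 s t1 s1 \<Longrightarrow> exec c2 s1 t2 s2 \<Longrightarrow> exec (Seq c1 c2) s (1 + t1 + t2) s2"
| Cond_true: "expr_val e s \<noteq> 0 \<Longrightarrow> exec c1 s t s1 \<Longrightarrow>
    exec (Cond e c1 c2) s (1 + expr_cost e + t) s1"
| Cond_false: "expr_val e s = 0 \<Longrightarrow> exec c2 s t s1 \<Longrightarrow>
    exec (Cond e c1 c2) s (1 + expr_cost e + t) s1"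
| While_false: "expr_val e s = 0 \<Longrightarrow> exec (While e c) s (1 + expr_cost e) s"
| While_true: "expr_val e s \<noteq> 0 \<Longrightarrow> exec c s t1 s1 \<Longrightarrow> exec (While e c) s1 t2 s2 \<Longrightarrow>
    exec (While e c) s (1 + expr_cost e + t1 + t2) s2"

lemma exec_deterministic:
  "exec c s t s1 \<Longrightarrow> exec c s u s2 \<Longrightarrow> u = t \<and> s2 = s1"
proof (induction arbitrary: u s2 rule: exec.induct)
  case (Seq c1 s t1 s1 c2 t2 s2')
  from Seq.prems obtain ta sa tb
    where "exec c1 s ta sa" "exec c2 sa tb s2" "u = 1 + ta + tb"
    by (cases rule: exec.cases) simp
  with Seq.IH show ?case by metis
next
  case (While_true e s c t1 s1 t2 s2')
  from While_true.prems While_true.hyps obtain ta sa tb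
    where "exec c s ta sa" "exec (While e c) sa tb s2" "u = 1 + expr_cost e + ta + tb"
    by (cases rule: exec.cases) simp_all
  with While_true.IH show ?case by metis
next
  case (Cond_true e s c1 t s1 c2)
  from Cond_true.prems Cond_true.hyps obtain ta
    where "exec c1 s ta s2" "u = 1 + expr_cost e + ta"
    by (cases rule: exec.cases) simp_all
  with Cond_true.IH show ?case by metis
next
  case (Cond_false e s c2 t s1 c1)
  from Cond_false.prems Cond_false.hyps obtain ta
    where "exec c2 s ta s2" "u = 1 + expr_cost e + ta"
    by (cases rule: exec.cases) simp_all
  with Cond_false.IH show ?case by metis
qed (erule exec.cases; simp)+

text \<open>Cell 0 of an input or output array holds the length of the word list that follows it.\<close>

definition init_store :: "nat list \<Rightarrow> store" where
  "init_store w = (\<lambda>_ _. 0)(''input'' := (\<lambda>k.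
     if k = 0 then length w else if k \<le> length w then w ! (k - 1) else 0))"

definition output_of :: "store \<Rightarrow> nat list" where
  "output_of s = map (\<lambda>k. s ''output'' (Suc k)) [0..<s ''output'' 0]"

definition computes :: "program \<Rightarrow> nat list \<Rightarrow> nat \<Rightarrow> nat list \<Rightarrow> bool" where
  "computes c w t out \<longleftrightarrow> (\<exists>s. exec c (init_store w) t s \<and> output_of s = out)"

section \<open>Encoding of instances and answers\<close>

text \<open>An explicit graph is given as its table of successors on the states \<open>0, \<dots>, n - 1\<close>.\<close>

definition is_table_of :: "nat list \<Rightarrow> fdds \<Rightarrow> bool" where
  "is_table_of t A \<longleftrightarrow> (\<forall>v\<in>set t. v < length t) \<and> A = abs_fdds ({..<length t}, \<lambda>u. t ! u)"

text \<open>
  A polynomial is given by its nonempty coefficients, each together with its exponent. Empty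
  coefficients have no states and are left out: a program could not even read all of them in
  time bounded in the number of states. The degree is thus not part of the size.
\<close>

definition is_table_of_poly :: "(nat \<times> nat list) list \<Rightarrow> fdds poly \<Rightarrow> bool" where
  "is_table_of_poly ts P \<longleftrightarrow>
     sorted_wrt (<) (map fst ts) \<and> fst ` set ts = {i. coeff P i \<noteq> 0} \<and>
     (\<forall>(i, t)\<in>set ts. is_table_of t (coeff P i))"

definition encode_table :: "nat list \<Rightarrow> nat list" where
  "encode_table t = length t # t"

definition encode_instance :: "(nat \<times> nat list) list \<Rightarrow> nat list \<Rightarrow> nat list" where
  "encode_instance ts b =
     length ts # concat (map (\<lambda>(i, t). i # encode_table t) ts) @ encode_table b"

definition instance_size :: "fdds poly \<Rightarrow> fdds \<Rightarrow> nat" where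
  "instance_size P B = (\<Sum>i\<le>degree P. num_states (coeff P i)) + num_states B"

text \<open>The answer is either \<open>0\<close> (no solution) or \<open>1\<close> followed by the encoding of a solution.\<close>

definition correct_answer :: "fdds poly \<Rightarrow> fdds \<Rightarrow> nat list \<Rightarrow> bool" where
  "correct_answer P B out \<longleftrightarrow>
     (if \<exists>X. is_perm X \<and> poly P X = B
      then \<exists>X x. is_perm X \<and> poly P X = B \<and> is_table_of x X \<and> out = 1 # encode_table x
      else out = [0])"

definition injective_on_perms :: "fdds poly \<Rightarrow> bool" where
  "injective_on_perms P \<longleftrightarrow> inj_on (poly P) {X. is_perm X}"

end

theory Submission
  imports Defs
begin

text \<open>
  For every \<open>n\<close>, counting the fixed points of the \<open>n\<close>-th iterate is a semiring homomorphism to the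
  naturals, and a permutation is determined by these counts for \<open>n\<close> up to its size. Hence
  \<open>P(X) = B\<close> splits into one equation \<open>P\<^sub>n(x\<^sub>n) = b\<^sub>n\<close> over the naturals for each \<open>n\<close>. If no
  coefficient of positive degree had a fixed point, two distinct permutations whose counts agree at
  all multiples of the cycle lengths \<open>2, \<dots>, M\<close> would have the same image under \<open>P\<close>. So
  injectivity yields such a coefficient, and every \<open>P\<^sub>n\<close> is strictly increasing with \<open>P\<^sub>n(x) \<ge> x\<close>.
  The solution can then be built greedily: for \<open>n = 1, 2, \<dots>\<close>, cycles of length \<open>n\<close> are added as
  long as \<open>P\<^sub>n(x\<^sub>n) < b\<^sub>n\<close>. Any solution contains every candidate built in this way, so it is enough
  to check the final candidate.
\<close>

section \<open>Counting fixed points of iterates\<close>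

text \<open>The count at \<open>n\<close> sees every cycle whose length divides \<open>n\<close>, so
  the lengths have to be settled in increasing order: an \<open>n\<close>-cycle leaves the counts at
  \<open>0 < k < n\<close> untouched, and a permutation whose first positive count is at
  \<open>n\<close> contains an \<open>n\<close>-cycle. This turns a deficit at \<open>n\<close> into
  a cycle that every solution must still contain. A fixed point in a coefficient is the right thing
  to look for because it is fixed by every iterate, so one coefficient serves all \<open>n\<close>
  at once. The search must stay short even if there is no solution. The bound
  \<open>x \<le> count_poly P n x\<close> ensures this: a deficit forces the count of the candidate
  below the input length \<open>L\<close>, so at most \<open>L\<close> cycles are added for each
  length. The other obstacle is the cost of evaluation. Without multiplication a power is computed
  by repeated addition, in time proportional to the exponent, while the degree is not bounded by the
  instance size. Hence exponents are cut off at \<open>L\<close>, and it has to be shown that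
  comparisons with counts of \<open>B\<close> do not notice this.\<close>

definition fixed_points :: "nat \<Rightarrow> 'a fun_graph \<Rightarrow> 'a set" where
  "fixed_points n A = {u \<in> fst A. (snd A ^^ n) u = u}"

lemma card_fixed_points_isom:
  assumes "is_fdds A" "isom A B"
  shows "card (fixed_points n A) = card (fixed_points n B)"
proof -
  obtain h where h: "bij_betw h (fst A) (fst B)" "\<forall>u\<in>fst A. h (snd A u) = snd B (h u)"
    using assms(2) unfolding isom_def by blast
  have it: "(snd A ^^ n) u \<in> fst A" "h ((snd A ^^ n) u) = (snd B ^^ n) (h u)" if "u \<in> fst A" for u
    using isom_funpow[OF assms(1) h(2) that] by auto
  have inj: "h x = h y \<longleftrightarrow> x = y" if "x \<in> fst A" "y \<in> fst A" for x y
    using h(1) that by (auto simp: bij_betw_def inj_on_def)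
  have "bij_betw h (fixed_points n A) (fixed_points n B)"
  proof (rule bij_betw_subset[OF h(1)])
    show "fixed_points n A \<subseteq> fst A" by (auto simp: fixed_points_def)
    show "h ` fixed_points n A = fixed_points n B"
    proof (intro equalityI subsetI)
      fix v assume "v \<in> h ` fixed_points n A"
      then obtain u where "u \<in> fst A" "(snd A ^^ n) u = u" "v = h u"
        by (auto simp: fixed_points_def)
      then show "v \<in> fixed_points n B"
        using it[of u] h(1) by (auto simp: fixed_points_def bij_betw_def)
    next
      fix v assume "v \<in> fixed_points n B"
      then have v: "v \<in> fst B" "(snd B ^^ n) v = v" by (auto simp: fixed_points_def)
      then obtain u where u: "u \<in> fst A" "v = h u" using h(1) by (auto simp: bij_betw_def)
      then have "(snd A ^^ n) u = u" using it[of u] inj[of "(snd A ^^ n) u" u] v by auto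
      then show "v \<in> h ` fixed_points n A" using u by (auto simp: fixed_points_def)
    qed
  qed
  then show ?thesis by (rule bij_betw_same_card)
qed

lemma funpow_map_sum:
  fixes f :: "'a \<Rightarrow> 'a" and g :: "'b \<Rightarrow> 'b"
  shows "(map_sum f g ^^ n) (Inl u) = Inl ((f ^^ n) u)"
  "(map_sum f g ^^ n) (Inr v) = Inr ((g ^^ n) v)"
  by (induction n) auto

lemma funpow_map_prod:
  fixes f :: "'a \<Rightarrow> 'a" and g :: "'b \<Rightarrow> 'b"
  shows "(map_prod f g ^^ n) (u, v) = ((f ^^ n) u, (g ^^ n) v)"
  by (induction n) auto

lemma fixed_points_disjoint_union:
  "fixed_points n (disjoint_union A B) = fixed_points n A <+> fixed_points n B"
  by (auto simp: fixed_points_def disjoint_union_def funpow_map_sum)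

lemma fixed_points_direct_product:
  "fixed_points n (direct_product A B) = fixed_points n A \<times> fixed_points n B"
  by (auto simp: fixed_points_def direct_product_def funpow_map_prod)

lemma finite_fixed_points: "is_fdds A \<Longrightarrow> finite (fixed_points n A)"
  by (simp add: is_fdds_def fixed_points_def)

text \<open>The count at 0 is the number of states, so sizes obey the same homomorphism laws as all
  other counts.\<close>

lemma fixed_points_0 [simp]: "fixed_points 0 A = fst A"
  by (simp add: fixed_points_def)

lemma funpow_mult_fixed: "(f ^^ n) u = u \<Longrightarrow> (f ^^ (n * m)) u = u"
  by (induction m) (auto simp: funpow_add)

lift_definition fix_count :: "nat \<Rightarrow> fdds \<Rightarrow> nat" is "\<lambda>n A. card (fixed_points n A)"
  by (simp add: card_fixed_points_isom)

lemma fix_count_0: "fix_count 0 A = num_states A"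
  by transfer simp

lemma fix_count_zero [simp]: "fix_count n 0 = 0"
  by transfer (simp add: fixed_points_def)

lemma fix_count_one [simp]: "fix_count n 1 = 1"
  by transfer (simp add: fixed_points_def)

lemma fix_count_add [simp]: "fix_count n (A + B) = fix_count n A + fix_count n B"
proof transfer
  fix n and A B :: "nat fun_graph"
  assume "is_fdds A \<and> is_fdds A \<and> isom A A" "is_fdds B \<and> is_fdds B \<and> isom B B"
  then show "card (fixed_points n (relabel sum_encode (disjoint_union A B))) =
      card (fixed_points n A) + card (fixed_points n B)"
    using card_fixed_points_isom[OF is_fdds_disjoint_union isom_relabel[OF inj_sum_encode]]
    by (metis card_Plus finite_fixed_points fixed_points_disjoint_union)
qed

lemma fix_count_mult [simp]: "fix_count n (A * B) = fix_count n A * fix_count n B"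
proof transfer
  fix n and A B :: "nat fun_graph"
  assume "is_fdds A \<and> is_fdds A \<and> isom A A" "is_fdds B \<and> is_fdds B \<and> isom B B"
  then show "card (fixed_points n (relabel prod_encode (direct_product A B))) =
      card (fixed_points n A) * card (fixed_points n B)"
    using card_fixed_points_isom[OF is_fdds_direct_product isom_relabel[OF inj_prod_encode]]
    by (metis card_cartesian_product fixed_points_direct_product)
qed

lemma fix_count_power [simp]: "fix_count n (A ^ k) = fix_count n A ^ k"
  by (induction k) auto

lemma fix_count_sum: "fix_count n (\<Sum>i\<in>I. A i) = (\<Sum>i\<in>I. fix_count n (A i))"
  by (induction I rule: infinite_finite_induct) auto

lemma fix_count_of_nat [simp]: "fix_count n (of_nat k) = k"
  by (induction k) auto

section \<open>Counts, sizes and permutations\<close>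

lemma fix_count_le: "fix_count n A \<le> num_states A"
  by transfer (auto simp: is_fdds_def fixed_points_def intro: card_mono)

lemma num_states_eq_0_iff: "num_states A = 0 \<longleftrightarrow> A = 0"
proof
  assume "num_states A = 0"
  then show "A = 0"
    by transfer (auto simp: is_fdds_def isom_def bij_betw_def)
qed (simp flip: fix_count_0)

text \<open>A state that returns after \<open>n\<close> steps returns after \<open>n * m\<close>
  steps. The case \<open>n = 1\<close> carries a fixed point to every iterate.\<close>

lemma fix_count_mult_le:
  "fix_count n A \<le> fix_count (n * m) A"
  by transfer (auto simp: is_fdds_def fixed_points_def funpow_mult_fixed intro!: card_mono)

text \<open>Expresses the property by an equation between counts, so that closure under sums and
  products follows from the homomorphism laws.\<close>

lemma is_perm_iff_fix_count: "is_perm A \<longleftrightarrow> (\<exists>n>0. fix_count n A = num_states A)"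
proof transfer
  fix A :: "nat fun_graph"
  assume "is_fdds A \<and> is_fdds A \<and> isom A A"
  then have fin: "finite (fst A)" by (simp add: is_fdds_def)
  show "only_cycles A \<longleftrightarrow> (\<exists>n>0. card (fixed_points n A) = card (fst A))"
  proof
    assume "only_cycles A"
    then obtain k where k: "\<And>u. u \<in> fst A \<Longrightarrow> k u > 0 \<and> (snd A ^^ k u) u = u"
      unfolding only_cycles_def by metis
    \<comment> \<open>The product of the individual periods is a period common to all
      states.\<close>
    let ?n = "\<Prod>u\<in>fst A. k u"
    have "(snd A ^^ ?n) u = u" if u: "u \<in> fst A" for u
    proof -
      have "?n = k u * (\<Prod>v\<in>fst A - {u}. k v)"
        using prod.remove[OF fin u] by simp
      then show ?thesis using k[OF u] funpow_mult_fixed by metis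
    qed
    then have "fixed_points ?n A = fst A" by (auto simp: fixed_points_def)
    then show "\<exists>n>0. card (fixed_points n A) = card (fst A)"
      using k by (intro exI[of _ ?n]) (auto intro: prod_pos)
  next
    assume "\<exists>n>0. card (fixed_points n A) = card (fst A)"
    then obtain n where n: "n > 0" "card (fixed_points n A) = card (fst A)" by blast
    then have "fixed_points n A = fst A"
      using fin by (intro card_subset_eq) (auto simp: fixed_points_def)
    then show "only_cycles A" using n(1) by (auto simp: only_cycles_def fixed_points_def)
  qed
qed

text \<open>Counts never drop when passing to a multiple and never exceed the size, so counts that
  are full at \<open>k\<close> and at \<open>l\<close> are both full at
  \<open>k * l\<close>.\<close>

lemma is_perm_common_period:
  assumes "is_perm A" "is_perm B"
  obtains n where "n > 0" "fix_count n A = num_states A" "fix_count n B = num_states B"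
proof -
  obtain k l where "k > 0" "fix_count k A = num_states A" "l > 0" "fix_count l B = num_states B"
    using assms unfolding is_perm_iff_fix_count by blast
  then show thesis
    using that[of "k * l"] fix_count_mult_le[of k A l] fix_count_mult_le[of l B k]
      fix_count_le[of "k * l"]
    by (metis le_antisym mult.commute nat_0_less_mult_iff)
qed

lemma is_perm_add:
  assumes "is_perm A" "is_perm B"
  shows "is_perm (A + B)"
proof -
  obtain n where "n > 0" "fix_count n A = num_states A" "fix_count n B = num_states B"
    using is_perm_common_period[OF assms] .
  then show ?thesis
    unfolding is_perm_iff_fix_count by (intro exI[of _ n]) (simp flip: fix_count_0)
qed

lemma is_perm_mult:
  assumes "is_perm A" "is_perm B"
  shows "is_perm (A * B)"
proof -
  obtain n where "n > 0" "fix_count n A = num_states A" "fix_count n B = num_states B"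
    using is_perm_common_period[OF assms] .
  then show ?thesis
    unfolding is_perm_iff_fix_count by (intro exI[of _ n]) (simp flip: fix_count_0)
qed

lemma is_perm_zero [simp]: "is_perm 0"
  by transfer (simp add: only_cycles_def)

lemma is_perm_one [simp]: "is_perm 1"
  using fix_count_0[of 1] by (auto simp: is_perm_iff_fix_count)

lemma is_perm_power: "is_perm A \<Longrightarrow> is_perm (A ^ k)"
  by (induction k) (auto intro: is_perm_mult)

lemma is_perm_sum: "(\<And>i. i \<in> I \<Longrightarrow> is_perm (A i)) \<Longrightarrow> is_perm (\<Sum>i\<in>I. A i)"
  by (induction I rule: infinite_finite_induct) (auto intro: is_perm_add)

lemma is_perm_of_nat: "is_perm (of_nat k)"
  by (induction k) (auto intro: is_perm_add)

lemma is_perm_poly: "(\<And>i. is_perm (coeff P i)) \<Longrightarrow> is_perm X \<Longrightarrow> is_perm (poly P X)"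
  unfolding poly_altdef by (intro is_perm_sum is_perm_mult is_perm_power)

section \<open>Cycles\<close>

definition cycle_graph :: "nat \<Rightarrow> nat fun_graph" where
  "cycle_graph n = ({..<n}, \<lambda>u. Suc u mod n)"

definition cycle :: "nat \<Rightarrow> fdds" where
  "cycle n = abs_fdds (cycle_graph n)"

lemma is_fdds_cycle_graph [simp]: "is_fdds (cycle_graph n)"
  by (auto simp: is_fdds_def cycle_graph_def)

lemma abs_fdds_eqI: "is_fdds A \<Longrightarrow> isom A B \<Longrightarrow> abs_fdds A = abs_fdds B"
  using is_fdds_isom by (intro Quotient_rel_abs[OF Quotient_fdds]) blast

lemma fix_count_abs_fdds: "is_fdds A \<Longrightarrow> fix_count n (abs_fdds A) = card (fixed_points n A)"
  by (rule fix_count.abs_eq) (simp add: eq_onp_def isom_refl)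

lemma num_states_abs_fdds: "is_fdds A \<Longrightarrow> num_states (abs_fdds A) = card (fst A)"
  using fix_count_abs_fdds[of A 0] by (simp add: fix_count_0)

text \<open>The \<open>n\<close>-th iterate is the rotation by \<open>n\<close>, which fixes all
  states or none.\<close>

lemma fix_count_cycle:
  assumes "m > 0"
  shows "fix_count n (cycle m) = (if m dvd n then m else 0)"
proof -
  have it: "(snd (cycle_graph m) ^^ n) u = (u + n) mod m" if "u < m" for u
    using that by (induction n) (auto simp: cycle_graph_def mod_Suc_eq)
  have "(u + n) mod m = u \<longleftrightarrow> m dvd n" if "u < m" for u
  proof -
    have "(u + n) mod m = u \<longleftrightarrow> (u + n) mod m = (u + 0) mod m" using that by simp
    also have "\<dots> \<longleftrightarrow> m dvd n"
      using mod_eq_dvd_iff_nat[of u "u + n" m] by (auto simp: ac_simps)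
    finally show ?thesis .
  qed
  then have "fixed_points n (cycle_graph m) = (if m dvd n then {..<m} else {})"
    using it by (auto simp: fixed_points_def) (auto simp: cycle_graph_def)
  then show ?thesis
    by (simp add: cycle_def fix_count_abs_fdds)
qed

lemma is_perm_cycle: "n > 0 \<Longrightarrow> is_perm (cycle n)"
  by (auto simp: is_perm_iff_fix_count fix_count_cycle simp flip: fix_count_0 intro!: exI[of _ n])

lemma abs_fdds_partition:
  assumes fd: "is_fdds A" and V: "fst A = S \<union> T" "S \<inter> T = {}"
    and S: "\<And>u. u \<in> S \<Longrightarrow> snd A u \<in> S" and T: "\<And>u. u \<in> T \<Longrightarrow> snd A u \<in> T"
  shows "abs_fdds A = abs_fdds (S, snd A) + abs_fdds (T, snd A)"
proof -
  have fS: "is_fdds (S, snd A)" and fT: "is_fdds (T, snd A)"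
    using assms by (auto simp: is_fdds_def)
  have iso: "isom A (disjoint_union (S, snd A) (T, snd A))"
    by (rule isomI[where h = "\<lambda>u. if u \<in> S then Inl u else Inr u" and g = "case_sum id id"])
      (use V S T in \<open>auto simp: disjoint_union_def\<close>)
  have "abs_fdds (S, snd A) + abs_fdds (T, snd A) =
      abs_fdds (relabel sum_encode (disjoint_union (S, snd A) (T, snd A)))"
    using fS fT by (intro plus_fdds.abs_eq) (simp_all add: eq_onp_def isom_refl)
  also have "\<dots> = abs_fdds A"
    using isom_trans[OF iso isom_relabel[OF inj_sum_encode]] fd by (intro abs_fdds_eqI[symmetric])
  finally show ?thesis by simp
qed

lemma abs_rep_fdds: "is_fdds (rep_fdds A)" "abs_fdds (rep_fdds A) = A"
  using Quotient_rep_reflp[OF Quotient_fdds, of A] Quotient_abs_rep[OF Quotient_fdds, of A] by auto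

text \<open>The orbit of a state of minimal period \<open>n\<close> is an \<open>n\<close>-cycle, and it splits off.\<close>

lemma split_cycle:
  assumes perm: "is_perm A" and n: "n > 0" "fix_count n A > 0"
    and min: "\<And>k. 0 < k \<Longrightarrow> k < n \<Longrightarrow> fix_count k A = 0"
  obtains R where "is_perm R" "A = cycle n + R"
proof -
  define G where "G = rep_fdds A"
  define V f where "V = fst G" and "f = snd G"
  have G: "is_fdds G" "abs_fdds G = A" using abs_rep_fdds by (auto simp: G_def)
  have count: "fix_count k A = card (fixed_points k G)" for k
    using fix_count_abs_fdds[OF G(1), of k] G(2) by simp
  have fin: "finite V" and closed: "\<And>u. u \<in> V \<Longrightarrow> f u \<in> V"
    using G(1) by (auto simp: is_fdds_def V_def f_def)
  have closed': "(f ^^ k) u \<in> V" if "u \<in> V" for u k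
    using that by (induction k) (auto simp: closed)
  have per: "\<exists>k>0. (f ^^ k) u = u" if "u \<in> V" for u
  proof -
    obtain k where k: "k > 0" "fix_count k A = num_states A" 
      using perm by (auto simp: is_perm_iff_fix_count)
    then have "card (fixed_points k G) = card (fst G)" 
      using count[of k] num_states_abs_fdds[OF G(1)] G(2) by simp
    then have "fixed_points k G = fst G"
      using fin by (intro card_subset_eq) (auto simp: fixed_points_def V_def)
    then show ?thesis using k that by (auto simp: fixed_points_def V_def f_def)
  qed
  have nofix: "(f ^^ k) v \<noteq> v" if "v \<in> V" "0 < k" "k < n" for k v
    using min[OF that(2,3)] count[of k] finite_fixed_points[OF G(1), of k] that(1)
    by (auto simp: fixed_points_def V_def f_def)
  have "fixed_points n G \<noteq> {}" using n(2) count[of n] by auto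
  then obtain u where u: "u \<in> V" "(f ^^ n) u = u"
    by (auto simp: fixed_points_def V_def f_def)
  define S where "S = (\<lambda>k. (f ^^ k) u) ` {..<n}"
  have SV: "S \<subseteq> V" using closed' u(1) by (auto simp: S_def)
  have period: "(f ^^ (k mod n)) u = (f ^^ k) u" for k
    using funpow_mod_eq[OF u(2)] by simp
  then have S_mem: "(f ^^ k) u \<in> S" for k
    using n(1) unfolding S_def by (metis imageI lessThan_iff mod_less_divisor)
  have Sf: "f v \<in> S" if "v \<in> S" for v
  proof -
    from that obtain k where "v = (f ^^ k) u" by (auto simp: S_def)
    then show ?thesis using S_mem[of "Suc k"] by simp
  qed
  \<comment> \<open>Periodicity makes the complement closed: a state outside the orbit whose
    successor lies in it would be led back to itself along the orbit, and so belong to it.\<close>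
  have Tf: "f v \<in> V - S" if v: "v \<in> V - S" for v
  proof (rule ccontr)
    assume "f v \<notin> V - S"
    then have "f v \<in> S" using v closed by auto
    then obtain k where k: "f v = (f ^^ k) u" by (auto simp: S_def)
    obtain m where m: "m > 0" "(f ^^ m) v = v" using per v by auto
    then have "v = (f ^^ (m - 1)) (f v)" by (metis Suc_pred' comp_apply funpow_Suc_right)
    also have "\<dots> = (f ^^ (m - 1 + k)) u" by (simp add: k funpow_add)
    finally show False using S_mem v by (metis DiffD2)
  qed
  have A: "A = abs_fdds (S, f) + abs_fdds (V - S, f)"
    using abs_fdds_partition[OF G(1), of S "V - S"] SV Sf Tf G(2)
    by (auto simp: V_def f_def)
  \<comment> \<open>A coincidence among the first \<open>n\<close> states of the orbit would give a
    state of period \<open>k - j\<close>, which is positive and below \<open>n\<close>, against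
    minimality.\<close>
  have inj_aux: "j = k" if "j \<le> k" "k < n" "(f ^^ j) u = (f ^^ k) u" for j k
  proof (rule ccontr)
    assume "j \<noteq> k"
    have "(f ^^ (k - j)) ((f ^^ j) u) = (f ^^ k) u"
      using that(1) by (metis comp_apply funpow_add le_add_diff_inverse2)
    then have "(f ^^ (k - j)) ((f ^^ j) u) = (f ^^ j) u" using that(3) by simp
    moreover have "(f ^^ j) u \<in> V" using closed' u(1) by blast
    ultimately show False using nofix[of "(f ^^ j) u" "k - j"] that(1,2) \<open>j \<noteq> k\<close> by simp
  qed
  have inj: "inj_on (\<lambda>k. (f ^^ k) u) {..<n}"
    by (rule inj_onI) (metis inj_aux lessThan_iff nle_le)
  have "isom (cycle_graph n) (S, f)"
    unfolding isom_def
  proof (intro exI[of _ "\<lambda>k. (f ^^ k) u"] conjI ballI)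
    show "bij_betw (\<lambda>k. (f ^^ k) u) (fst (cycle_graph n)) (fst (S, f))"
      using inj by (simp add: bij_betw_def S_def cycle_graph_def)
    show "(f ^^ snd (cycle_graph n) k) u = snd (S, f) ((f ^^ k) u)" for k
      using period[of "Suc k"] by (simp add: cycle_graph_def)
  qed
  then have "cycle n = abs_fdds (S, f)"
    unfolding cycle_def by (intro abs_fdds_eqI) auto
  moreover have fT: "is_fdds (V - S, f)" using fin Tf by (auto simp: is_fdds_def)
  have "is_perm (abs_fdds (V - S, f))"
    unfolding is_perm_iff_fix_count num_states_abs_fdds[OF fT] fix_count_abs_fdds[OF fT]
  proof -
    obtain k where k: "k > 0" "fix_count k A = num_states A"
      using perm by (auto simp: is_perm_iff_fix_count)
    \<comment> \<open>The counts of the two summands add up to the full size and neither exceeds the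
      size of its own summand, so both are full.\<close>
    then have "fix_count k (abs_fdds (V - S, f)) = num_states (abs_fdds (V - S, f))"
      using fix_count_le[of k "abs_fdds (S, f)"] fix_count_le[of k "abs_fdds (V - S, f)"]
      by (simp add: A flip: fix_count_0)
    then show "\<exists>n>0. card (fixed_points n (V - S, f)) = card (fst (V - S, f))"
      using k(1) num_states_abs_fdds[OF fT] fix_count_abs_fdds[OF fT] by auto
  qed
  ultimately show thesis using that A by metis
qed

text \<open>The least \<open>n\<close> with a positive count is bounded by the size because the
  \<open>n\<close>-cycle that splits off there already has \<open>n\<close> states.\<close>

lemma nonzero_perm_has_cycle:
  assumes "is_perm A" "A \<noteq> 0"
  obtains n where "0 < n" "n \<le> num_states A" "0 < fix_count n A"
    "\<And>k. 0 < k \<Longrightarrow> k < n \<Longrightarrow> fix_count k A = 0"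
proof -
  have ex: "\<exists>n. n > 0 \<and> fix_count n A > 0"
    using assms num_states_eq_0_iff[of A] by (metis gr0I is_perm_iff_fix_count)
  define n where "n = (LEAST n. n > 0 \<and> fix_count n A > 0)"
  have n: "n > 0" "fix_count n A > 0" using LeastI_ex[OF ex] by (auto simp: n_def)
  have min: "fix_count k A = 0" if "0 < k" "k < n" for k
    using not_less_Least[of k "\<lambda>n. n > 0 \<and> fix_count n A > 0"] that by (auto simp: n_def)
  obtain R where "A = cycle n + R" using split_cycle[OF assms(1) n min] by auto
  then have "num_states A \<ge> n" 
    using n by (simp add: fix_count_cycle flip: fix_count_0)
  then show thesis using that n min by blast
qed

text \<open>Equal counts first become positive at the same \<open>n\<close>, so an
  \<open>n\<close>-cycle splits off from both sides and the induction continues with the rests.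
  \<open>N\<close> bounds both sizes so that this \<open>n\<close> lies in the tested range.\<close>

lemma perm_eqI:
  assumes "is_perm A" "is_perm B" "num_states A \<le> N" "num_states B \<le> N"
    and "\<And>n. 0 < n \<Longrightarrow> n \<le> N \<Longrightarrow> fix_count n A = fix_count n B"
  shows "A = B"
  using assms
proof (induction "num_states A" arbitrary: A B rule: less_induct)
  case less
  show ?case
  proof (cases "A = 0")
    case True
    show ?thesis
    proof (rule ccontr)
      assume "A \<noteq> B"
      then obtain n where "0 < n" "n \<le> num_states B" "0 < fix_count n B"
        using nonzero_perm_has_cycle[OF less.prems(2)] True by metis
      then show False using less.prems(4) less.prems(5)[of n] True by simp
    qed
  next
    case False
    obtain n where n: "0 < n" "n \<le> num_states A" "0 < fix_count n A"
      "\<And>k. 0 < k \<Longrightarrow> k < n \<Longrightarrow> fix_count k A = 0"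
      using nonzero_perm_has_cycle[OF less.prems(1) False] by metis
    have nB: "0 < fix_count n B" "\<And>k. 0 < k \<Longrightarrow> k < n \<Longrightarrow> fix_count k B = 0"
      using less.prems(3,5) n by (metis order_trans, metis less_imp_le order_trans)
    obtain R where R: "is_perm R" "A = cycle n + R" using split_cycle[OF less.prems(1) n(1,3,4)] by blast
    obtain R' where R': "is_perm R'" "B = cycle n + R'"
      using split_cycle[OF less.prems(2) n(1) nB] by blast
    have "num_states A = n + num_states R" "num_states B = n + num_states R'"
      using n(1) by (simp_all add: R R' fix_count_cycle flip: fix_count_0)
    then have "R = R'"
      using R R' less.prems n by (intro less.hyps) auto
    then show ?thesis using R R' by simp
  qed
qed

section \<open>Polynomials injective on permutations\<close>

definition count_poly :: "fdds poly \<Rightarrow> nat \<Rightarrow> nat \<Rightarrow> nat" where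
  "count_poly P n x = (\<Sum>i\<le>degree P. fix_count n (coeff P i) * x ^ i)"

lemma fix_count_poly: "fix_count n (poly P X) = count_poly P n (fix_count n X)"
  by (simp add: poly_altdef count_poly_def fix_count_sum)

text \<open>\<open>Y - X\<close> is the product over \<open>2 \<le> m \<le> M\<close> of \<open>m - C\<^sub>m\<close>, where \<open>C\<^sub>m\<close> is the cycle of
  length \<open>m\<close>, multiplied out into its positive and its negative part.\<close>

lemma perms_differing_in_fixed_points:
  "\<exists>X Y. is_perm X \<and> is_perm Y \<and> fix_count 1 X \<noteq> fix_count 1 Y \<and>
    (\<forall>n m. 2 \<le> m \<longrightarrow> m \<le> M \<longrightarrow> m dvd n \<longrightarrow> fix_count n X = fix_count n Y)"
proof (induction M)
  case 0
  show ?case by (rule exI[of _ 0], rule exI[of _ 1]) auto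
next
  case (Suc M)
  then obtain X Y where XY: "is_perm X" "is_perm Y" "fix_count 1 X \<noteq> fix_count 1 Y"
    "\<And>n m. 2 \<le> m \<Longrightarrow> m \<le> M \<Longrightarrow> m dvd n \<Longrightarrow> fix_count n X = fix_count n Y"
    by blast
  show ?case
  proof (cases "M = 0")
    case True
    \<comment> \<open>The new length is 1, and no \<open>m\<close> satisfies
      \<open>2 \<le> m \<le> 1\<close>.\<close>
    then show ?thesis using XY by (intro exI[of _ X] exI[of _ Y]) auto
  next
    case False
    let ?m = "Suc M"
    let ?X = "of_nat ?m * X + cycle ?m * Y" and ?Y = "of_nat ?m * Y + cycle ?m * X"
    have "is_perm ?X" "is_perm ?Y"
      using XY(1,2) by (auto intro!: is_perm_add is_perm_mult is_perm_of_nat is_perm_cycle simp del: of_nat_Suc)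
    \<comment> \<open>A cycle of length at least 2 has no fixed point, so both fixed point counts
      are just multiplied by \<open>?m\<close> and stay different.\<close>
    moreover have "fix_count 1 ?X \<noteq> fix_count 1 ?Y"
      using XY(3) False by (simp add: fix_count_cycle del: of_nat_Suc mult_Suc)
    moreover have "fix_count n ?X = fix_count n ?Y" if "2 \<le> m" "m \<le> ?m" "m dvd n" for n m
    proof (cases "m = ?m")
      case True
      \<comment> \<open>At multiples of \<open>?m\<close> the cycle has count \<open>?m\<close> as
        well, and both sides become \<open>?m\<close> times the sum of the counts of
        \<open>X\<close> and \<open>Y\<close>.\<close>
      then show ?thesis using that(3) by (simp add: fix_count_cycle del: of_nat_Suc)
    next
      case False
      then have "fix_count n X = fix_count n Y" using XY(4)[of m n] that by simp
      then show ?thesis by simp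
    qed
    ultimately show ?thesis by blast
  qed
qed

text \<open>Let \<open>m\<close> be the smallest cycle length. Either \<open>m\<close> divides
  \<open>n\<close> and is the answer, or the split-off cycle contributes nothing at \<open>n\<close>
  and the rest inherits the positive count.\<close>

lemma fix_count_pos_imp_cycle:
  assumes "is_perm A" "0 < fix_count n A" "0 < n"
  obtains m where "0 < m" "m \<le> num_states A" "m dvd n" "0 < fix_count m A"
  using assms
proof (induction "num_states A" arbitrary: A thesis rule: less_induct)
  case less
  have "A \<noteq> 0" using less.prems by auto
  then obtain m where m: "0 < m" "m \<le> num_states A" "0 < fix_count m A"
    "\<And>k. 0 < k \<Longrightarrow> k < m \<Longrightarrow> fix_count k A = 0"
    using nonzero_perm_has_cycle[OF less.prems(2)] by metis
  obtain R where R: "is_perm R" "A = cycle m + R"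
    using split_cycle[OF less.prems(2) m(1,3,4)] by blast
  have size: "num_states A = m + num_states R"
    using m(1) by (simp add: R fix_count_cycle flip: fix_count_0)
  show ?case
  proof (cases "m dvd n")
    case True
    then show ?thesis using less.prems(1)[of m] m by blast
  next
    case False
    then have "0 < fix_count n R" using less.prems(3) R m(1) by (simp add: fix_count_cycle)
    moreover have "num_states R < num_states A" using size m(1) by simp
    ultimately obtain l where "0 < l" "l \<le> num_states R" "l dvd n" "0 < fix_count l R"
      using less.hyps[of R] R(1) less.prems(4) by blast
    then show ?thesis using less.prems(1)[of l] size R(2) by simp
  qed
qed

lemma injective_imp_fixed_point:
  assumes perm: "\<And>i. is_perm (coeff P i)" and inj: "injective_on_perms P"
  shows "\<exists>i>0. i \<le> degree P \<and> 0 < fix_count 1 (coeff P i)"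
proof (rule ccontr)
  assume no: "\<not> ?thesis"
  have none: "fix_count 1 (coeff P i) = 0" if "0 < i" "i \<le> degree P" for i
  proof (rule ccontr)
    assume "fix_count 1 (coeff P i) \<noteq> 0"
    then have "0 < fix_count 1 (coeff P i)" by simp
    with that no show False by blast
  qed
  \<comment> \<open>Bounds the length of every cycle in a coefficient.\<close>
  define M where "M = (\<Sum>i\<le>degree P. num_states (coeff P i))"
  obtain X Y where XY: "is_perm X" "is_perm Y" "fix_count 1 X \<noteq> fix_count 1 Y"
    "\<And>n m. 2 \<le> m \<Longrightarrow> m \<le> M \<Longrightarrow> m dvd n \<Longrightarrow> fix_count n X = fix_count n Y"
    using perms_differing_in_fixed_points[of M] by blast
  have "poly P X = poly P Y"
  proof (rule perm_eqI[OF _ _ max.cobounded1 max.cobounded2])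
    fix n :: nat assume n: "0 < n"
    \<comment> \<open>The constant term does not depend on the argument. Any other term vanishes
      unless its coefficient has a cycle length \<open>m\<close> dividing \<open>n\<close>; then
      \<open>m = 1\<close> is excluded by \<open>none\<close>, and \<open>X\<close> and
      \<open>Y\<close> have equal counts at \<open>n\<close>.\<close>
    have "fix_count n (coeff P i) * fix_count n X ^ i = fix_count n (coeff P i) * fix_count n Y ^ i"
      if i: "i \<le> degree P" for i
    proof (cases "i = 0 \<or> fix_count n (coeff P i) = 0")
      case False
      then obtain m where m: "0 < m" "m \<le> num_states (coeff P i)" "m dvd n" "0 < fix_count m (coeff P i)"
        using fix_count_pos_imp_cycle[OF perm _ n, of i] by blast
      have "m \<noteq> 1" using none[of i] False i m(4) by auto
      moreover have "m \<le> M"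
        using m(2) member_le_sum[of i "{..degree P}" "\<lambda>i. num_states (coeff P i)"] i
        by (simp add: M_def)
      ultimately show ?thesis using XY(4)[of m n] m by simp
    qed auto
    then show "fix_count n (poly P X) = fix_count n (poly P Y)"
      by (auto simp: fix_count_poly count_poly_def intro!: sum.cong)
  qed (use perm XY(1,2) in \<open>auto intro: is_perm_poly\<close>)
  then show False using inj XY(1-3) by (auto simp: injective_on_perms_def inj_on_def)
qed

text \<open>A fixed point is fixed by every iterate, so one coefficient of positive degree has count
  at least 1 at all \<open>n\<close>, including 0. The second inequality limits both the length of
  the search and, at \<open>n = 0\<close>, the size of a solution.\<close>

lemma
  assumes perm: "\<And>i. is_perm (coeff P i)" and inj: "injective_on_perms P"
  shows count_poly_less: "x < y \<Longrightarrow> count_poly P n x < count_poly P n y"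
    and count_poly_ge: "x \<le> count_poly P n x"
proof -
  obtain i where i: "0 < i" "i \<le> degree P" "0 < fix_count 1 (coeff P i)"
    using injective_imp_fixed_point[OF assms] by metis
  have pos: "0 < fix_count n (coeff P i)" using i(3) fix_count_mult_le[of 1 "coeff P i" n] by simp
  show "count_poly P n x < count_poly P n y" if "x < y"
    unfolding count_poly_def
  proof (rule sum_strict_mono_ex1)
    show "\<forall>i\<in>{..degree P}. fix_count n (coeff P i) * x ^ i \<le> fix_count n (coeff P i) * y ^ i"
      using that by (auto intro!: mult_left_mono power_mono)
    show "\<exists>i\<in>{..degree P}. fix_count n (coeff P i) * x ^ i < fix_count n (coeff P i) * y ^ i"
      using that i pos by (intro bexI[of _ i]) (auto intro!: power_strict_mono)
  qed auto
  have "x \<le> fix_count n (coeff P i) * x ^ i"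
    using pos i(1) self_le_power[of x i] by (cases "x = 0")
      (auto intro: order_trans[of _ "1 * x ^ i"])
  also have "\<dots> \<le> count_poly P n x"
    unfolding count_poly_def by (rule member_le_sum) (use i in auto)
  finally show "x \<le> count_poly P n x" .
qed

lemma count_poly_less_iff:
  assumes "\<And>i. is_perm (coeff P i)" "injective_on_perms P"
  shows "count_poly P n x < count_poly P n y \<longleftrightarrow> x < y"
  using count_poly_less[OF assms] by (metis linorder_neqE_nat order_less_asym)

section \<open>Time-bounded execution\<close>

text \<open>Total correctness with a time bound. Because \<open>exec\<close> is deterministic, the
  existence of such a run speaks about the only run.\<close>

definition runs :: "program \<Rightarrow> store \<Rightarrow> nat \<Rightarrow> (store \<Rightarrow> bool) \<Rightarrow> bool" where
  "runs c s T Q \<longleftrightarrow> (\<exists>t s'. exec c s t s' \<and> t \<le> T \<and> Q s')"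

primrec writes :: "program \<Rightarrow> string set" where
  "writes Skip = {}"
| "writes (Write a i e) = {a}"
| "writes (Seq c1 c2) = writes c1 \<union> writes c2"
| "writes (Cond e c1 c2) = writes c1 \<union> writes c2"
| "writes (While e c) = writes c"

lemma exec_frame: "exec c s t s' \<Longrightarrow> a \<notin> writes c \<Longrightarrow> s' a = s a"
  by (induction rule: exec.induct) auto

text \<open>The frame condition is built into the rule, so that a specification only has to mention
  what its program computes.\<close>

lemma runs_weaken:
  assumes "runs c s T Q" "T \<le> T'"
    and "\<And>s'. Q s' \<Longrightarrow> (\<And>a. a \<notin> writes c \<Longrightarrow> s' a = s a) \<Longrightarrow> Q' s'"
  shows "runs c s T' Q'"
  using assms exec_frame unfolding runs_def by (meson order_trans)

lemma runs_Seq: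
  assumes "runs c1 s T1 R"
    and "\<And>s1. R s1 \<Longrightarrow> (\<And>a. a \<notin> writes c1 \<Longrightarrow> s1 a = s a) \<Longrightarrow> runs c2 s1 T2 Q"
  shows "runs (Seq c1 c2) s (1 + T1 + T2) Q"
proof -
  obtain t1 s1 where 1: "exec c1 s t1 s1" "t1 \<le> T1" "R s1"
    using assms(1) unfolding runs_def by blast
  then have "runs c2 s1 T2 Q" using assms(2) exec_frame by blast
  then obtain t2 s2 where 2: "exec c2 s1 t2 s2" "t2 \<le> T2" "Q s2"
    unfolding runs_def by blast
  show ?thesis
    unfolding runs_def using exec.Seq[OF 1(1) 2(1)] 1(2) 2(2,3)
    by (intro exI[of _ "1 + t1 + t2"] exI[of _ s2]) auto
qed

text \<open>\<open>m\<close> is fuel: the second premise makes it a successor whenever the guard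
  holds, so the loop has stopped when the fuel is gone. The number of rounds may be smaller than
  \<open>m\<close>.\<close>

lemma runs_While_variant:
  assumes "I m s"
    and "\<And>m s'. I m s' \<Longrightarrow> expr_val e s' \<noteq> 0 \<Longrightarrow> (\<And>a. a \<notin> writes c \<Longrightarrow> s' a = s a) \<Longrightarrow>
      \<exists>m'. m = Suc m' \<and> runs c s' T (I m')"
  shows "runs (While e c) s (m * (1 + expr_cost e + T) + 1 + expr_cost e)
    (\<lambda>s'. expr_val e s' = 0 \<and> (\<exists>m'. I m' s'))"
proof -
  let ?W = "\<lambda>m s. runs (While e c) s (m * (1 + expr_cost e + T) + 1 + expr_cost e)
    (\<lambda>s'. expr_val e s' = 0 \<and> (\<exists>m'. I m' s'))"
  have "?W m s'" if "I m s'" "\<And>a. a \<notin> writes c \<Longrightarrow> s' a = s a" for s'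
    using that
  proof (induction m arbitrary: s')
    case 0
    have "expr_val e s' = 0" using assms(2)[OF 0(1) _ 0(2)] by auto
    then show ?case
      unfolding runs_def using exec.While_false[of e s' c] 0(1) by auto
  next
    case (Suc m)
    show ?case
    proof (cases "expr_val e s' = 0")
      case True
      then show ?thesis
        unfolding runs_def using exec.While_false[of e s' c] Suc.prems(1)
        by (intro exI[of _ "1 + expr_cost e"] exI[of _ s']) auto
    next
      case False
      then have "runs c s' T (I m)" using assms(2)[OF Suc.prems(1) _ Suc.prems(2)] by auto
      then obtain t1 s1 where 1: "exec c s' t1 s1" "t1 \<le> T" "I m s1"
        unfolding runs_def by blast
      have "s1 a = s a" if "a \<notin> writes c" for a
        using exec_frame[OF 1(1) that] Suc.prems(2)[OF that] by simp
      then have "?W m s1" using Suc.IH 1(3) by blast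
      then obtain t2 s2 where 2: "exec (While e c) s1 t2 s2"
          "t2 \<le> m * (1 + expr_cost e + T) + 1 + expr_cost e"
          "expr_val e s2 = 0 \<and> (\<exists>m'. I m' s2)"
        unfolding runs_def by blast
      have "exec (While e c) s' (1 + expr_cost e + t1 + t2) s2"
        using exec.While_true[OF False 1(1) 2(1)] .
      moreover have "1 + expr_cost e + t1 + t2 \<le> Suc m * (1 + expr_cost e + T) + 1 + expr_cost e"
        using 1(2) 2(2) by simp
      ultimately show ?thesis using 2(3) unfolding runs_def by blast
    qed
  qed
  then show ?thesis using assms(1) by blast
qed

text \<open>The variant rule with \<open>n - k\<close> rounds left. The frame condition is carried
  inside \<open>?J\<close> so that the premises can be applied to the final store.\<close>

lemma runs_While_count:
  assumes "I 0 s"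
    and "\<And>k s'. I k s' \<Longrightarrow> (\<And>a. a \<notin> writes c \<Longrightarrow> s' a = s a) \<Longrightarrow> k < n \<Longrightarrow>
      expr_val e s' \<noteq> 0 \<and> runs c s' T (I (Suc k))"
    and "\<And>s'. I n s' \<Longrightarrow> (\<And>a. a \<notin> writes c \<Longrightarrow> s' a = s a) \<Longrightarrow> expr_val e s' = 0"
  shows "runs (While e c) s (n * (1 + expr_cost e + T) + 1 + expr_cost e) (I n)"
proof -
  let ?J = "\<lambda>m s'. (\<forall>a. a \<notin> writes c \<longrightarrow> s' a = s a) \<and> m \<le> n \<and> I (n - m) s'"
  have step: "runs c s' T (?J m')" if "?J (Suc m') s'" for m' s'
  proof (rule runs_weaken[where Q = "I (n - m')"])
    have "n - m' = Suc (n - Suc m')" using that by auto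
    then show "runs c s' T (I (n - m'))" using assms(2)[of "n - Suc m'" s'] that by auto
    show "?J m' s1" if "I (n - m') s1" "\<And>a. a \<notin> writes c \<Longrightarrow> s1 a = s' a" for s1
      using that \<open>?J (Suc m') s'\<close> by auto
  qed auto
  have "runs (While e c) s (n * (1 + expr_cost e + T) + 1 + expr_cost e)
    (\<lambda>s'. expr_val e s' = 0 \<and> (\<exists>m'. ?J m' s'))"
  proof (rule runs_While_variant)
    show "?J n s" using assms(1) by simp
    show "\<exists>m'. m = Suc m' \<and> runs c s' T (?J m')" if J: "?J m s'" and nz: "expr_val e s' \<noteq> 0" for m s'
    proof (cases m)
      case 0
      then show ?thesis using J nz assms(3)[of s'] by auto
    next
      case (Suc m')
      then show ?thesis using step J by blast
    qed
  qed
  then show ?thesis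
  proof (rule runs_weaken)
    fix s' assume "expr_val e s' = 0 \<and> (\<exists>m'. ?J m' s')"
    then obtain m' where "expr_val e s' = 0" "?J m' s'" by blast
    \<comment> \<open>With rounds left, the second premise would make the guard nonzero.\<close>
    moreover from this have "m' = 0" using assms(2)[of "n - m'" s'] by fastforce
    ultimately show "I n s'" by simp
  qed auto
qed

section \<open>Programs without loops\<close>

primrec loop_free :: "program \<Rightarrow> bool" where
  "loop_free Skip = True"
| "loop_free (Write a i e) = True"
| "loop_free (Seq c1 c2) = (loop_free c1 \<and> loop_free c2)"
| "loop_free (Cond e c1 c2) = (loop_free c1 \<and> loop_free c2)"
| "loop_free (While e c) = False"

primrec effect :: "program \<Rightarrow> store \<Rightarrow> store" where
  "effect Skip s = s"
| "effect (Write a i e) s = s(a := (s a)(expr_val i s := expr_val e s))"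
| "effect (Seq c1 c2) s = effect c2 (effect c1 s)"
| "effect (Cond e c1 c2) s = (if expr_val e s = 0 then effect c2 s else effect c1 s)"
| "effect (While e c) s = s"

text \<open>The costs of both branches are added, which bounds the cost whichever branch is taken.
  The value for loops is a dummy, as it is in \<open>effect\<close>.\<close>

primrec cost_bound :: "program \<Rightarrow> nat" where
  "cost_bound Skip = 1"
| "cost_bound (Write a i e) = 1 + expr_cost i + expr_cost e"
| "cost_bound (Seq c1 c2) = 1 + cost_bound c1 + cost_bound c2"
| "cost_bound (Cond e c1 c2) = 1 + expr_cost e + cost_bound c1 + cost_bound c2"
| "cost_bound (While e c) = 0"

lemma exec_effect: "loop_free c \<Longrightarrow> \<exists>t\<le>cost_bound c. exec c s t (effect c s)"
proof (induction c arbitrary: s)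
  case (Seq c1 c2)
  then obtain t1 t2 where "t1 \<le> cost_bound c1" "exec c1 s t1 (effect c1 s)"
    "t2 \<le> cost_bound c2" "exec c2 (effect c1 s) t2 (effect c2 (effect c1 s))"
    by fastforce
  then show ?case
    using exec.Seq[of c1 s t1 "effect c1 s" c2 t2] by (intro exI[of _ "1 + t1 + t2"]) auto
next
  case Skip
  show ?case using exec.Skip[of s] by auto
next
  case (Write a i e)
  show ?case using exec.Write[of a i e s] by (simp only: effect.simps cost_bound.simps) blast
next
  case (Cond e c1 c2)
  show ?case
  proof (cases "expr_val e s = 0")
    case True
    obtain t where "t \<le> cost_bound c2" "exec c2 s t (effect c2 s)"
      using Cond by fastforce
    then show ?thesis
      using exec.Cond_false[OF True] True by (intro exI[of _ "1 + expr_cost e + t"]) auto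
  next
    case False
    obtain t where "t \<le> cost_bound c1" "exec c1 s t (effect c1 s)"
      using Cond by fastforce
    then show ?thesis
      using exec.Cond_true[OF False] False by (intro exI[of _ "1 + expr_cost e + t"]) auto
  qed
qed simp

text \<open>Replaces derivations in \<open>exec\<close> by symbolic evaluation of
  \<open>effect\<close> and \<open>cost_bound\<close>, which simplification can carry out.\<close>

lemma runs_loop_free:
  "loop_free c \<Longrightarrow> cost_bound c \<le> T \<Longrightarrow> Q (effect c s) \<Longrightarrow> runs c s T Q"
  unfolding runs_def using exec_effect order_trans by blast

section \<open>Tables in the store\<close>

abbreviation var :: "string \<Rightarrow> expr" where
  "var x \<equiv> Read x (Const 0)"

abbreviation assign :: "string \<Rightarrow> expr \<Rightarrow> program" where
  "assign x e \<equiv> Write x (Const 0) e"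

abbreviation increment :: "string \<Rightarrow> program" where
  "increment x \<equiv> assign x (Add (var x) (Const 1))"

definition table_at :: "(nat \<Rightarrow> nat) \<Rightarrow> nat \<Rightarrow> nat list \<Rightarrow> bool" where
  "table_at f p t \<longleftrightarrow> f p = length t \<and> (\<forall>k<length t. f (p + 1 + k) = t ! k)"

definition closed_table :: "nat list \<Rightarrow> bool" where
  "closed_table t \<longleftrightarrow> (\<forall>v\<in>set t. v < length t)"

definition table_fix_count :: "nat \<Rightarrow> nat list \<Rightarrow> nat" where
  "table_fix_count n t = card {u. u < length t \<and> ((\<lambda>v. t ! v) ^^ n) u = u}"

lemma funpow_table_less:
  "closed_table t \<Longrightarrow> u < length t \<Longrightarrow> ((\<lambda>v. t ! v) ^^ n) u < length t"
  by (induction n) (auto simp: closed_table_def)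

lemma table_fix_count_le: "table_fix_count n t \<le> length t"
  using card_mono[of "{..<length t}" "{u. u < length t \<and> ((\<lambda>v. t ! v) ^^ n) u = u}"]
  by (auto simp: table_fix_count_def)

text \<open>The scalars \<open>p\<close> and \<open>n\<close> hold the cell at which a table starts and the number of iterations,
  and the count is returned in \<open>c\<close>.\<close>

definition iterate_prog :: "string \<Rightarrow> program" where
  "iterate_prog a = While (Sub (var ''n'') (var ''k''))
    (Seq (assign ''v'' (Read a (Add (Add (var ''p'') (Const 1)) (var ''v'')))) (increment ''k''))"

text \<open>With truncated subtraction, \<open>v - u\<close> plus \<open>u - v\<close> is zero
  exactly when \<open>u\<close> and \<open>v\<close> are equal; this serves as the equality
  test.\<close>

definition count_fixed_prog :: "string \<Rightarrow> program" where
  "count_fixed_prog a = Seq (Seq (assign ''c'' (Const 0)) (assign ''u'' (Const 0)))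
    (While (Sub (Read a (var ''p'')) (var ''u''))
      (Seq (Seq (assign ''v'' (var ''u'')) (assign ''k'' (Const 0)))
        (Seq (iterate_prog a)
          (Seq (Cond (Add (Sub (var ''v'') (var ''u'')) (Sub (var ''u'') (var ''v'')))
              Skip (increment ''c''))
            (increment ''u'')))))"

lemma writes_iterate_prog [simp]: "writes (iterate_prog a) = {''v'', ''k''}"
  by (auto simp: iterate_prog_def)

lemma writes_count_fixed_prog [simp]: "writes (count_fixed_prog a) = {''c'', ''u'', ''v'', ''k''}"
  by (auto simp: count_fixed_prog_def)

text \<open>Restricting \<open>a\<close> to two names keeps the table apart from the scalars being
  assigned. The constants 30 and 10 round up the cost of a round and of the exit test; later time
  bounds are rounded up likewise.\<close>

lemma runs_iterate_prog:
  assumes a: "a \<in> {''input'', ''output''}"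
    and t: "table_at (s a) (s ''p'' 0) t" "closed_table t" "s ''v'' 0 = u" "u < length t" "s ''k'' 0 = 0"
  shows "runs (iterate_prog a) s (s ''n'' 0 * 30 + 10) (\<lambda>s'. s' ''v'' 0 = ((\<lambda>v. t ! v) ^^ s ''n'' 0) u)"
proof -
  let ?n = "s ''n'' 0"
  have neq: "a \<noteq> ''k''" "a \<noteq> ''v''" "a \<noteq> ''p''" "a \<noteq> ''n''" using a by auto
  have "runs (iterate_prog a) s (?n * (1 + expr_cost (Sub (var ''n'') (var ''k'')) + 20) + 1
        + expr_cost (Sub (var ''n'') (var ''k'')))
      (\<lambda>s'. s' ''k'' 0 = ?n \<and> s' ''v'' 0 = ((\<lambda>v. t ! v) ^^ ?n) u)"
    unfolding iterate_prog_def
  proof (rule runs_While_count[where n = ?n and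
        I = "\<lambda>k s'. s' ''k'' 0 = k \<and> s' ''v'' 0 = ((\<lambda>v. t ! v) ^^ k) u"], goal_cases)
    case 1
    show ?case using t by simp
  next
    case (2 k s')
    have frame: "s' ''p'' = s ''p''" "s' ''n'' = s ''n''" "s' a = s a"
      using 2(2) neq by simp_all
    have "s a (Suc (s ''p'' 0 + s' ''v'' 0)) = t ! (s' ''v'' 0)"
      using t(1) funpow_table_less[OF t(2,4), of k] 2(1) by (simp add: table_at_def)
    then show ?case
      by (intro conjI runs_loop_free) (use 2(1,3) frame neq in simp_all)
  next
    case (3 s')
    then show ?case by simp
  qed
  then show ?thesis by (rule runs_weaken) auto
qed

lemma runs_count_fixed_prog:
  assumes a: "a \<in> {''input'', ''output''}"
    and t: "table_at (s a) (s ''p'' 0) t" "closed_table t"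
  shows "runs (count_fixed_prog a) s (length t * (s ''n'' 0 * 30 + 80) + 30)
    (\<lambda>s'. s' ''c'' 0 = table_fix_count (s ''n'' 0) t)"
proof -
  let ?n = "s ''n'' 0" and ?f = "\<lambda>v. t ! v"
  have neq: "a \<noteq> ''c''" "a \<noteq> ''u''" "a \<noteq> ''k''" "a \<noteq> ''v''" "a \<noteq> ''p''" "a \<noteq> ''n''" using a by auto
  let ?I = "\<lambda>k s'. s' ''u'' 0 = k \<and> s' ''c'' 0 = card {u. u < k \<and> (?f ^^ ?n) u = u}"
  have step: "{u. u < Suc k \<and> (?f ^^ ?n) u = u} =
      (if (?f ^^ ?n) k = k then insert k {u. u < k \<and> (?f ^^ ?n) u = u}
       else {u. u < k \<and> (?f ^^ ?n) u = u})" for k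
    by (auto simp: less_Suc_eq)
  have "runs (count_fixed_prog a) s (1 + 10 + (length t * (1 + 6 + (?n * 30 + 62)) + 1 + 6)) (?I (length t))"
    unfolding count_fixed_prog_def
  proof (rule runs_Seq[where R = "?I 0"], goal_cases)
    case 1
    show ?case by (rule runs_loop_free) auto
  next
    case (2 s1)
    have s1: "s1 ''p'' = s ''p''" "s1 ''n'' = s ''n''" "s1 a = s a"
      using 2(2) neq by simp_all
    let ?e = "Sub (Read a (var ''p'')) (var ''u'')"
    have e: "expr_cost ?e = 6" by simp
    show ?case
    proof (rule runs_While_count[where e = ?e, unfolded e], goal_cases)
      case 1
      show ?case using 2 by simp
    next
      case (2 k s2)
      have s2: "s2 ''p'' = s ''p''" "s2 ''n'' = s ''n''" "s2 a = s a"
        using 2(2) neq s1 by simp_all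
      let ?I2 = "\<lambda>s'. ?I k s' \<and> s' ''p'' = s ''p'' \<and> s' ''n'' = s ''n'' \<and> s' a = s a"
      have "expr_val ?e s2 \<noteq> 0" using 2 s2 t(1) by (simp add: table_at_def)
      moreover have "runs (Seq (Seq (assign ''v'' (var ''u'')) (assign ''k'' (Const 0)))
        (Seq (iterate_prog a)
          (Seq (Cond (Add (Sub (var ''v'') (var ''u'')) (Sub (var ''u'') (var ''v'')))
              Skip (increment ''c''))
            (increment ''u'')))) s2 (1 + 10 + (1 + (?n * 30 + 10) + 40)) (?I (Suc k))"
      proof (rule runs_Seq[where R = "\<lambda>s'. ?I2 s' \<and> s' ''v'' 0 = k \<and> s' ''k'' 0 = 0"], goal_cases)
        case 1
        show ?case by (rule runs_loop_free) (use 2 s2 neq in auto)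
      next
        case (2 s3)
        show ?case
        proof (rule runs_Seq[where R = "\<lambda>s'. ?I2 s' \<and> s' ''v'' 0 = (?f ^^ ?n) k"], goal_cases)
          case 1
          have "runs (iterate_prog a) s3 (s3 ''n'' 0 * 30 + 10)
              (\<lambda>s'. s' ''v'' 0 = (?f ^^ s3 ''n'' 0) k)"
            by (rule runs_iterate_prog[OF a, where u = k]) (use 2 t \<open>k < length t\<close> in auto)
          then show ?case
            by (rule runs_weaken) (use 2 neq in auto)
        next
          case (2 s4)
          then show ?case
            by (intro runs_loop_free) (auto simp: step card_insert_if)
        qed
      qed
      ultimately show ?case by (simp add: algebra_simps)
    next
      case (3 s2)
      have "s2 ''p'' = s ''p''" "s2 a = s a"
        using 3(2) neq s1 by simp_all
      then show ?case using 3 t(1) by (simp add: table_at_def)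
    qed
  qed
  then show ?thesis
    by (rule runs_weaken) (auto simp: table_fix_count_def algebra_simps)
qed

text \<open>Each multiplication by \<open>x\<close> is done by \<open>x\<close> additions. The time
  is proportional to the exponent, which is why exponents get capped.\<close>

definition power_prog :: program where
  "power_prog = Seq (Seq (assign ''y'' (Const 1)) (assign ''g'' (Const 0)))
    (While (Sub (var ''i'') (var ''g''))
      (Seq (Seq (assign ''z'' (Const 0)) (assign ''h'' (Const 0)))
        (Seq (While (Sub (var ''x'') (var ''h''))
            (Seq (assign ''z'' (Add (var ''z'') (var ''y''))) (increment ''h'')))
          (Seq (assign ''y'' (var ''z'')) (increment ''g'')))))"

lemma writes_power_prog [simp]: "writes power_prog = {''y'', ''g'', ''z'', ''h''}"
  by (auto simp: power_prog_def)

text \<open>Stated for arbitrary names because it serves twice: inside the power loop and for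
  multiplying a power by its coefficient.\<close>

lemma runs_add_repeatedly:
  assumes "s h 0 = 0" "distinct [n, h, z, y]"
  shows "runs (While (Sub (var n) (var h)) (Seq (assign z (Add (var z) (var y))) (increment h))) s
    (s n 0 * 30 + 10) (\<lambda>s'. s' z 0 = s z 0 + s n 0 * s y 0)"
proof -
  let ?e = "Sub (var n) (var h)"
  have e: "expr_cost ?e = 5" by simp
  have "runs (While ?e (Seq (assign z (Add (var z) (var y))) (increment h))) s
      (s n 0 * (1 + 5 + 20) + 1 + 5) (\<lambda>s'. s' h 0 = s n 0 \<and> s' z 0 = s z 0 + s n 0 * s y 0)"
  proof (rule runs_While_count[where e = ?e and
      I = "\<lambda>k s'. s' h 0 = k \<and> s' z 0 = s z 0 + k * s y 0", unfolded e], goal_cases)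
    case 1
    show ?case using assms by simp
  next
    case (2 k s')
    have "s' n = s n" "s' y = s y" using 2(2) assms by auto
    then show ?case
      by (intro conjI runs_loop_free) (use 2(1,3) assms(2) in auto)
  next
    case (3 s')
    have "s' n = s n" using 3(2) assms by auto
    then show ?case using 3(1) by simp
  qed
  then show ?thesis by (rule runs_weaken) simp_all
qed

lemma runs_power_prog:
  "runs power_prog s (s ''i'' 0 * (s ''x'' 0 * 30 + 60) + 30) (\<lambda>s'. s' ''y'' 0 = s ''x'' 0 ^ s ''i'' 0)"
proof -
  let ?i = "s ''i'' 0" and ?x = "s ''x'' 0"
  let ?I = "\<lambda>k s'. s' ''g'' 0 = k \<and> s' ''y'' 0 = ?x ^ k"
  have "runs power_prog s (1 + 10 + (?i * (1 + 5 + (?x * 30 + 42)) + 1 + 5)) (?I ?i)"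
    unfolding power_prog_def
  proof (rule runs_Seq[where R = "?I 0"], goal_cases)
    case 1
    show ?case by (rule runs_loop_free) auto
  next
    case (2 s1)
    have s1: "s1 ''i'' = s ''i''" "s1 ''x'' = s ''x''" using 2(2) by simp_all
    let ?e = "Sub (var ''i'') (var ''g'')"
    have e: "expr_cost ?e = 5" by simp
    show ?case
    proof (rule runs_While_count[where e = ?e, unfolded e], goal_cases)
      case 1
      show ?case using 2 by simp
    next
      case (2 k s2)
      have s2: "s2 ''i'' = s ''i''" "s2 ''x'' = s ''x''" using 2(2) s1 by simp_all
      have "runs (Seq (Seq (assign ''z'' (Const 0)) (assign ''h'' (Const 0)))
        (Seq (While (Sub (var ''x'') (var ''h''))
            (Seq (assign ''z'' (Add (var ''z'') (var ''y''))) (increment ''h'')))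
          (Seq (assign ''y'' (var ''z'')) (increment ''g''))))
          s2 (1 + 10 + (1 + (?x * 30 + 10) + 20)) (?I (Suc k))"
      proof (rule runs_Seq[where R = "\<lambda>s'. ?I k s' \<and> s' ''x'' = s ''x'' \<and> s' ''z'' 0 = 0 \<and> s' ''h'' 0 = 0"], goal_cases)
        case 1
        show ?case by (rule runs_loop_free) (use 2 s2 in auto)
      next
        case (2 s3)
        show ?case
        proof (rule runs_Seq[where R = "\<lambda>s'. s' ''g'' 0 = k \<and> s' ''z'' 0 = ?x ^ Suc k"], goal_cases)
          case 1
          have "runs (While (Sub (var ''x'') (var ''h''))
            (Seq (assign ''z'' (Add (var ''z'') (var ''y''))) (increment ''h''))) s3 (s3 ''x'' 0 * 30 + 10)
            (\<lambda>s'. s' ''z'' 0 = s3 ''z'' 0 + s3 ''x'' 0 * s3 ''y'' 0)"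
            by (rule runs_add_repeatedly) (use 2 in auto)
          then show ?case by (rule runs_weaken) (use 2 in auto)
        next
          case (2 s4)
          then show ?case by (intro runs_loop_free) auto
        qed
      qed
      then show ?case using 2 s2 by (simp add: algebra_simps)
    next
      case (3 s2)
      then show ?case using s1 by simp
    qed
  qed
  then show ?thesis by (rule runs_weaken) (auto simp: algebra_simps)
qed

section \<open>Evaluating the polynomial on fixed point counts\<close>

text \<open>The 2 in the offset accounts for the exponent and the length word in front of the table
  entries.\<close>

primrec poly_at :: "(nat \<Rightarrow> nat) \<Rightarrow> nat \<Rightarrow> (nat \<times> nat list) list \<Rightarrow> bool" where
  "poly_at f q [] = True"
| "poly_at f q (a # ts) \<longleftrightarrow> f q = fst a \<and> table_at f (q + 1) (snd a) \<and> poly_at f (q + 2 + length (snd a)) ts"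

text \<open>The first cell behind the coefficients. For \<open>q = 2\<close>, behind the input
  length and the number of coefficients, it is where the table of \<open>B\<close> starts.\<close>

definition poly_end :: "nat \<Rightarrow> (nat \<times> nat list) list \<Rightarrow> nat" where
  "poly_end q ts = q + (\<Sum>a\<leftarrow>ts. 2 + length (snd a))"

definition table_poly :: "nat \<Rightarrow> nat \<Rightarrow> nat \<Rightarrow> (nat \<times> nat list) list \<Rightarrow> nat" where
  "table_poly L n x ts = (\<Sum>a\<leftarrow>ts. table_fix_count n (snd a) * x ^ min (fst a) L)"

lemma poly_at_nth:
  "poly_at f q ts \<Longrightarrow> k < length ts \<Longrightarrow>
    f (poly_end q (take k ts)) = fst (ts ! k) \<and> table_at f (poly_end q (take k ts) + 1) (snd (ts ! k))"
proof (induction ts arbitrary: q k)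
  case (Cons a ts)
  show ?case
  proof (cases k)
    case 0
    then show ?thesis using Cons.prems by (simp add: poly_end_def)
  next
    case (Suc k')
    then show ?thesis
      using Cons.IH[of "q + 2 + length (snd a)" k'] Cons.prems by (simp add: poly_end_def algebra_simps)
  qed
qed simp

lemma poly_end_take_Suc:
  "k < length ts \<Longrightarrow> poly_end q (take (Suc k) ts) = poly_end q (take k ts) + 2 + length (snd (ts ! k))"
  by (simp add: poly_end_def take_Suc_conv_app_nth)

lemma table_poly_take_Suc:
  "k < length ts \<Longrightarrow> table_poly L n x (take (Suc k) ts) =
    table_poly L n x (take k ts) + table_fix_count n (snd (ts ! k)) * x ^ min (fst (ts ! k)) L"
  by (simp add: table_poly_def take_Suc_conv_app_nth)

text \<open>The exponent is capped at the length of the input, which exceeds every count in \<open>B\<close>: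
  this affects the value only where it is too large to matter.\<close>

definition eval_step :: program where
  "eval_step =
    Seq (Seq (Seq (assign ''i'' (Read ''input'' (var ''q'')))
          (assign ''i'' (Sub (var ''i'') (Sub (var ''i'') (Read ''input'' (Const 0))))))
        (assign ''p'' (Add (var ''q'') (Const 1))))
    (Seq (count_fixed_prog ''input'')
    (Seq power_prog
    (Seq (assign ''h'' (Const 0))
    (Seq (While (Sub (var ''c'') (var ''h''))
        (Seq (assign ''e'' (Add (var ''e'') (var ''y''))) (increment ''h'')))
      (Seq (assign ''q'' (Add (Add (var ''p'') (Const 1)) (Read ''input'' (var ''p''))))
        (increment ''j''))))))"

definition eval_prog :: program where
  "eval_prog = Seq (Seq (Seq (assign ''e'' (Const 0)) (assign ''q'' (Const 2))) (assign ''j'' (Const 0)))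
    (While (Sub (Read ''input'' (Const 1)) (var ''j'')) eval_step)"

lemma writes_eval_step [simp]:
  "writes eval_step = {''c'', ''u'', ''v'', ''k'', ''y'', ''g'', ''z'', ''h'', ''e'', ''q'', ''j'', ''i'', ''p''}"
  by (auto simp: eval_step_def)

lemma writes_eval_prog [simp]:
  "writes eval_prog = {''c'', ''u'', ''v'', ''k'', ''y'', ''g'', ''z'', ''h'', ''e'', ''q'', ''j'', ''i'', ''p''}"
  by (auto simp: eval_prog_def)

text \<open>\<open>L\<close> bounds what is read from the input, \<open>X\<close> the count of the
  candidate, which may be longer than the input.\<close>

definition step_time :: "nat \<Rightarrow> nat \<Rightarrow> nat" where
  "step_time L X = L * (L * 30 + 80) + L * (X * 30 + 60) + L * 30 + 200"

lemma runs_eval_step: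
  assumes Q: "s ''q'' 0 = Q" "s ''input'' Q = i" "table_at (s ''input'') (Q + 1) t" "closed_table t"
    and le: "length t \<le> L" "s ''n'' 0 \<le> L" "s ''x'' 0 \<le> X" and L: "s ''input'' 0 = L"
  shows "runs eval_step s (step_time L X) (\<lambda>s'. s' ''q'' 0 = Q + 2 + length t \<and> s' ''j'' 0 = Suc (s ''j'' 0) \<and>
    s' ''e'' 0 = s ''e'' 0 + table_fix_count (s ''n'' 0) t * s ''x'' 0 ^ min i L)"
proof -
  let ?n = "s ''n'' 0" and ?x = "s ''x'' 0"
  define C where "C = table_fix_count ?n t"
  have C: "C \<le> L" using table_fix_count_le[of ?n t] le(1) by (simp add: C_def)
  let ?K = "\<lambda>s'. s' ''input'' = s ''input'' \<and> s' ''n'' 0 = ?n \<and> s' ''x'' 0 = ?x \<and> s' ''j'' 0 = s ''j'' 0 \<and> s' ''p'' 0 = Q + 1"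
  have "runs eval_step s
    (1 + 30 + (1 + (length t * (?n * 30 + 80) + 30) + (1 + (min i L * (?x * 30 + 60) + 30) + (1 + 10 +
      (1 + (C * 30 + 10) + 40)))))
    (\<lambda>s'. s' ''q'' 0 = Q + 2 + length t \<and> s' ''j'' 0 = Suc (s ''j'' 0) \<and>
    s' ''e'' 0 = s ''e'' 0 + C * ?x ^ min i L)"
    unfolding eval_step_def
  proof (rule runs_Seq[where R = "\<lambda>s'. ?K s' \<and> s' ''e'' 0 = s ''e'' 0 \<and> s' ''i'' 0 = min i L"], goal_cases)
    case 1
    \<comment> \<open>With truncated subtraction, \<open>i - (i - L)\<close> is
      \<open>min i L\<close>.\<close>
    show ?case by (rule runs_loop_free) (use Q L in auto)
  next
    case (2 s1)
    show ?case
    proof (rule runs_Seq[where R = "\<lambda>s'. ?K s' \<and> s' ''e'' 0 = s ''e'' 0 \<and> s' ''i'' 0 = min i L \<and> s' ''c'' 0 = C"], goal_cases)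
      case 1
      have "runs (count_fixed_prog ''input'') s1 (length t * (s1 ''n'' 0 * 30 + 80) + 30)
        (\<lambda>s'. s' ''c'' 0 = table_fix_count (s1 ''n'' 0) t)"
        by (rule runs_count_fixed_prog) (use 2 Q in auto)
      then show ?case by (rule runs_weaken) (use 2 in \<open>auto simp: C_def\<close>)
    next
      case (2 s2)
      show ?case
      proof (rule runs_Seq[where R = "\<lambda>s'. ?K s' \<and> s' ''e'' 0 = s ''e'' 0 \<and> s' ''c'' 0 = C \<and> s' ''y'' 0 = ?x ^ min i L"], goal_cases)
        case 1
        show ?case by (rule runs_weaken[OF runs_power_prog]) (use 2 in auto)
      next
        case (2 s3)
        show ?case
        proof (rule runs_Seq[where R = "\<lambda>s'. ?K s' \<and> s' ''e'' 0 = s ''e'' 0 \<and> s' ''c'' 0 = C \<and> s' ''y'' 0 = ?x ^ min i L \<and> s' ''h'' 0 = 0"], goal_cases)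
          case 1
          show ?case by (rule runs_loop_free) (use 2 in auto)
        next
          case (2 s4)
          show ?case
          proof (rule runs_Seq[where R = "\<lambda>s'. ?K s' \<and> s' ''e'' 0 = s ''e'' 0 + C * ?x ^ min i L"], goal_cases)
            case 1
            show ?case by (rule runs_weaken[OF runs_add_repeatedly]) (use 2 in auto)
          next
            case (2 s5)
            then show ?case
              by (intro runs_loop_free) (use 2 Q in \<open>auto simp: table_at_def\<close>)
          qed
        qed
      qed
    qed
  qed
  then show ?thesis
  proof (rule runs_weaken)
    have "length t * (?n * 30 + 80) \<le> L * (L * 30 + 80)"
      using le by (intro mult_le_mono) auto
    moreover have "min i L * (?x * 30 + 60) \<le> L * (X * 30 + 60)"
      using le by (intro mult_le_mono) auto
    ultimately show "1 + 30 + (1 + (length t * (?n * 30 + 80) + 30) + (1 + (min i L * (?x * 30 + 60) + 30) + (1 + 10 +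
      (1 + (C * 30 + 10) + 40)))) \<le> step_time L X"
      unfolding step_time_def using C by linarith
  qed (simp add: C_def)
qed

definition eval_time :: "nat \<Rightarrow> nat \<Rightarrow> nat" where
  "eval_time L X = L * (step_time L X + 10) + 50"

lemma runs_eval_prog:
  assumes inp: "s ''input'' 0 = L" "s ''input'' 1 = length ts" "poly_at (s ''input'') 2 ts"
    and ts: "\<And>a. a \<in> set ts \<Longrightarrow> closed_table (snd a) \<and> length (snd a) \<le> L" "length ts \<le> L"
    and le: "s ''n'' 0 \<le> L" "s ''x'' 0 \<le> X"
  shows "runs eval_prog s (eval_time L X)
    (\<lambda>s'. s' ''e'' 0 = table_poly L (s ''n'' 0) (s ''x'' 0) ts \<and> s' ''q'' 0 = poly_end 2 ts)"
proof -
  let ?I = "\<lambda>k s'. s' ''j'' 0 = k \<and> s' ''q'' 0 = poly_end 2 (take k ts) \<and>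
    s' ''e'' 0 = table_poly L (s ''n'' 0) (s ''x'' 0) (take k ts)"
  let ?e = "Sub (Read ''input'' (Const 1)) (var ''j'')"
  have e: "expr_cost ?e = 5" by simp
  have "runs eval_prog s (1 + 20 + (length ts * (1 + 5 + step_time L X) + 1 + 5)) (?I (length ts))"
    unfolding eval_prog_def
  proof (rule runs_Seq[where R = "?I 0"], goal_cases)
    case 1
    show ?case by (rule runs_loop_free) (auto simp: poly_end_def table_poly_def)
  next
    case (2 s1)
    have s1: "s1 ''input'' = s ''input''" "s1 ''n'' = s ''n''" "s1 ''x'' = s ''x''" using 2(2) by simp_all
    show ?case
    proof (rule runs_While_count[where e = ?e, unfolded e], goal_cases)
      case 1
      show ?case using 2 by simp
    next
      case (2 k s2)
      have s2: "s2 ''input'' = s ''input''" "s2 ''n'' = s ''n''" "s2 ''x'' = s ''x''"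
        using 2(2) s1 by simp_all
      have k: "ts ! k \<in> set ts" using 2(3) by simp
      have "runs eval_step s2 (step_time L X) (\<lambda>s'. s' ''q'' 0 = poly_end 2 (take k ts) + 2 + length (snd (ts ! k)) \<and>
        s' ''j'' 0 = Suc (s2 ''j'' 0) \<and>
        s' ''e'' 0 = s2 ''e'' 0 + table_fix_count (s2 ''n'' 0) (snd (ts ! k)) * s2 ''x'' 0 ^ min (fst (ts ! k)) L)"
        by (rule runs_eval_step)
          (use 2(1) s2 inp poly_at_nth[OF inp(3) 2(3)] ts(1)[OF k] le in auto)
      then have "runs eval_step s2 (step_time L X) (?I (Suc k))"
        by (rule runs_weaken)
          (use 2(1) s2 poly_end_take_Suc[OF 2(3)] table_poly_take_Suc[OF 2(3)] in auto)
      then show ?case using 2(1,3) s2 inp by simp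
    next
      case (3 s2)
      then show ?case using s1 inp by simp
    qed
  qed
  then show ?thesis
  proof (rule runs_weaken)
    have "length ts * (1 + 5 + step_time L X) \<le> L * (step_time L X + 10)"
      using ts(2) by (intro mult_le_mono) auto
    then show "1 + 20 + (length ts * (1 + 5 + step_time L X) + 1 + 5) \<le> eval_time L X"
      unfolding eval_time_def by linarith
  qed simp
qed

text \<open>Sets \<open>e\<close> to the count of the polynomial at the candidate solution and \<open>c\<close> to the count of \<open>B\<close>.
  The candidate is kept in the output array from cell 2 on, its place in the final answer.\<close>

definition probe_prog :: program where
  "probe_prog = Seq (assign ''p'' (Const 2))
    (Seq (count_fixed_prog ''output'')
    (Seq (assign ''x'' (var ''c''))
    (Seq eval_prog
    (Seq (assign ''p'' (var ''q''))
      (count_fixed_prog ''input'')))))"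

lemma writes_probe_prog [simp]:
  "writes probe_prog = {''c'', ''u'', ''v'', ''k'', ''y'', ''g'', ''z'', ''h'', ''e'', ''q'', ''j'', ''i'', ''p'', ''x''}"
  by (auto simp: probe_prog_def)

definition probe_time :: "nat \<Rightarrow> nat \<Rightarrow> nat" where
  "probe_time L X = X * (L * 30 + 80) + eval_time L X + L * (L * 30 + 80) + 200"

lemma runs_probe_prog:
  assumes inp: "s ''input'' 0 = L" "s ''input'' 1 = length ts" "poly_at (s ''input'') 2 ts"
      "table_at (s ''input'') (poly_end 2 ts) b"
    and ts: "\<And>a. a \<in> set ts \<Longrightarrow> closed_table (snd a) \<and> length (snd a) \<le> L" "length ts \<le> L"
    and b: "closed_table b" "length b \<le> L"
    and xs: "table_at (s ''output'') 2 xs" "closed_table xs" "length xs \<le> X"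
    and n: "s ''n'' 0 \<le> L"
  shows "runs probe_prog s (probe_time L X)
    (\<lambda>s'. s' ''e'' 0 = table_poly L (s ''n'' 0) (table_fix_count (s ''n'' 0) xs) ts \<and>
      s' ''c'' 0 = table_fix_count (s ''n'' 0) b)"
proof -
  let ?n = "s ''n'' 0"
  define x where "x = table_fix_count ?n xs"
  have x: "x \<le> X" using table_fix_count_le[of ?n xs] xs(3) by (simp add: x_def)
  let ?K = "\<lambda>s'. s' ''input'' = s ''input'' \<and> s' ''output'' = s ''output'' \<and> s' ''n'' 0 = ?n"
  have "runs probe_prog s
    (1 + 10 + (1 + (length xs * (?n * 30 + 80) + 30) + (1 + 10 + (1 + eval_time L X + (1 + 10 +
      (length b * (?n * 30 + 80) + 30))))))
    (\<lambda>s'. s' ''e'' 0 = table_poly L ?n x ts \<and> s' ''c'' 0 = table_fix_count ?n b)"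
    unfolding probe_prog_def
  proof (rule runs_Seq[where R = "\<lambda>s'. ?K s' \<and> s' ''p'' 0 = 2"], goal_cases)
    case 1
    show ?case by (rule runs_loop_free) auto
  next
    case (2 s1)
    show ?case
    proof (rule runs_Seq[where R = "\<lambda>s'. ?K s' \<and> s' ''c'' 0 = x"], goal_cases)
      case 1
      have "runs (count_fixed_prog ''output'') s1 (length xs * (s1 ''n'' 0 * 30 + 80) + 30)
        (\<lambda>s'. s' ''c'' 0 = table_fix_count (s1 ''n'' 0) xs)"
        by (rule runs_count_fixed_prog) (use 2 xs in auto)
      then show ?case by (rule runs_weaken) (use 2 in \<open>auto simp: x_def\<close>)
    next
      case (2 s2)
      show ?case
      proof (rule runs_Seq[where R = "\<lambda>s'. ?K s' \<and> s' ''x'' 0 = x"], goal_cases)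
        case 1
        show ?case by (rule runs_loop_free) (use 2 in auto)
      next
        case (2 s3)
        show ?case
        proof (rule runs_Seq[where R = "\<lambda>s'. ?K s' \<and> s' ''e'' 0 = table_poly L ?n x ts \<and> s' ''q'' 0 = poly_end 2 ts"], goal_cases)
          case 1
          show ?case
            by (rule runs_weaken[OF runs_eval_prog[where L = L and ts = ts and X = X]])
              (use 2 inp ts n x in auto)
        next
          case (2 s4)
          show ?case
          proof (rule runs_Seq[where R = "\<lambda>s'. ?K s' \<and> s' ''e'' 0 = table_poly L ?n x ts \<and> s' ''p'' 0 = poly_end 2 ts"], goal_cases)
            case 1
            show ?case by (rule runs_loop_free) (use 2 in auto)
          next
            case (2 s5)
            have "runs (count_fixed_prog ''input'') s5 (length b * (s5 ''n'' 0 * 30 + 80) + 30)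
              (\<lambda>s'. s' ''c'' 0 = table_fix_count (s5 ''n'' 0) b)"
              by (rule runs_count_fixed_prog) (use 2 inp b in auto)
            then show ?case by (rule runs_weaken) (use 2 in auto)
          qed
        qed
      qed
    qed
  qed
  then show ?thesis
  proof (rule runs_weaken)
    have "length xs * (?n * 30 + 80) \<le> X * (L * 30 + 80)"
      using xs(3) n by (intro mult_le_mono) auto
    moreover have "length b * (?n * 30 + 80) \<le> L * (L * 30 + 80)"
      using b(2) n by (intro mult_le_mono) auto
    ultimately show "1 + 10 + (1 + (length xs * (?n * 30 + 80) + 30) + (1 + 10 + (1 + eval_time L X + (1 + 10 +
      (length b * (?n * 30 + 80) + 30))))) \<le> probe_time L X"
      unfolding probe_time_def by linarith
  qed (simp add: x_def)
qed

section \<open>Extending the candidate by a cycle\<close>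

definition cycle_table :: "nat \<Rightarrow> nat \<Rightarrow> nat list" where
  "cycle_table l n = map (\<lambda>k. l + Suc k mod n) [0..<n]"

text \<open>No remainder is computed: every new state first points to the next cell's state, and the
  last entry is then overwritten by \<open>l\<close>, which closes the cycle. The length word is
  updated at the end.\<close>

definition add_cycle_prog :: program where
  "add_cycle_prog = Seq (Seq (assign ''l'' (Read ''output'' (Const 2))) (assign ''k'' (Const 0)))
    (Seq (While (Sub (var ''n'') (var ''k''))
        (Seq (Write ''output'' (Add (Const 3) (Add (var ''l'') (var ''k'')))
            (Add (var ''l'') (Add (var ''k'') (Const 1))))
          (increment ''k'')))
      (Seq (Write ''output'' (Add (Const 2) (Add (var ''l'') (var ''n''))) (var ''l''))
        (Write ''output'' (Const 2) (Add (var ''l'') (var ''n'')))))"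

lemma writes_add_cycle_prog [simp]: "writes add_cycle_prog = {''output'', ''l'', ''k''}"
  by (auto simp: add_cycle_prog_def)

lemma table_at_append_cycle:
  assumes "f 2 = length xs + n" "\<And>i. i < length xs \<Longrightarrow> f (3 + i) = xs ! i"
    and "\<And>i. Suc i < n \<Longrightarrow> f (3 + (length xs + i)) = length xs + Suc i"
    and "f (2 + (length xs + n)) = length xs" "0 < n"
  shows "table_at f 2 (xs @ cycle_table (length xs) n)"
proof -
  have "f (2 + 1 + k) = (xs @ cycle_table (length xs) n) ! k" if k: "k < length xs + n" for k
  proof (cases "k < length xs")
    case True
    then show ?thesis using assms(2)[of k] by (simp add: nth_append)
  next
    case False
    define i where "i = k - length xs"
    have i: "k = length xs + i" "i < n" using False k by (auto simp: i_def)
    show ?thesis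
    proof (cases "Suc i = n")
      case True
      then have "2 + 1 + k = 2 + (length xs + n)" using i(1) by simp
      then have "f (2 + 1 + k) = length xs" using assms(4) by metis
      then show ?thesis using True i by (simp add: nth_append cycle_table_def)
    next
      case False
      then have "Suc i < n" using i(2) by simp
      then show ?thesis using assms(3)[of i] i by (simp add: nth_append cycle_table_def)
    qed
  qed
  then show ?thesis using assms(1) by (simp add: table_at_def cycle_table_def)
qed

lemma runs_add_cycle_prog:
  assumes xs: "table_at (s ''output'') 2 xs" and n: "0 < s ''n'' 0"
  shows "runs add_cycle_prog s (s ''n'' 0 * 40 + 60)
    (\<lambda>s'. table_at (s' ''output'') 2 (xs @ cycle_table (length xs) (s ''n'' 0)))"
proof -
  let ?n = "s ''n'' 0" and ?l = "length xs"
  let ?I = "\<lambda>k s'. s' ''k'' 0 = k \<and> s' ''l'' 0 = ?l \<and> s' ''output'' 2 = ?l \<and>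
    (\<forall>i<?l. s' ''output'' (3 + i) = xs ! i) \<and> (\<forall>i<k. s' ''output'' (3 + (?l + i)) = ?l + Suc i)"
  let ?e = "Sub (var ''n'') (var ''k'')"
  have e: "expr_cost ?e = 5" by simp
  have "runs add_cycle_prog s (1 + 10 + (1 + (?n * (1 + 5 + 30) + 1 + 5) + 30))
    (\<lambda>s'. table_at (s' ''output'') 2 (xs @ cycle_table ?l ?n))"
    unfolding add_cycle_prog_def
  proof (rule runs_Seq[where R = "\<lambda>s'. ?I 0 s' \<and> s' ''n'' 0 = ?n"], goal_cases)
    case 1
    show ?case by (rule runs_loop_free) (use xs in \<open>auto simp: table_at_def\<close>)
  next
    case (2 s1)
    show ?case
    proof (rule runs_Seq[where R = "\<lambda>s'. ?I ?n s' \<and> s' ''n'' 0 = ?n"], goal_cases)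
      case 1
      have "runs (While ?e
        (Seq (Write ''output'' (Add (Const 3) (Add (var ''l'') (var ''k'')))
            (Add (var ''l'') (Add (var ''k'') (Const 1))))
          (increment ''k''))) s1 (?n * (1 + 5 + 30) + 1 + 5) (?I ?n)"
      proof (rule runs_While_count[where e = ?e, unfolded e], goal_cases)
        case 1
        show ?case using 2 by simp
      next
        case (2 k s2)
        have "s2 ''n'' 0 = ?n" using 2(2) \<open>?I 0 s1 \<and> s1 ''n'' 0 = ?n\<close> by simp
        then show ?case
          by (intro conjI runs_loop_free) (use 2(1,3) in \<open>simp_all add: less_Suc_eq\<close>)
      next
        case (3 s2)
        then show ?case using 2 by simp
      qed
      then show ?case by (rule runs_weaken) (use 2 in auto)
    next
      case (2 s2)
      show ?case
      proof (rule runs_loop_free)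
        show "table_at (effect (Seq (Write ''output'' (Add (Const 2) (Add (var ''l'') (var ''n''))) (var ''l''))
          (Write ''output'' (Const 2) (Add (var ''l'') (var ''n'')))) s2 ''output'') 2 (xs @ cycle_table ?l ?n)"
          by (rule table_at_append_cycle) (use 2(1) n in auto)
      qed auto
    qed
  qed
  then show ?thesis by (rule runs_weaken) auto
qed

section \<open>Tables as systems\<close>

definition table_fdds :: "nat list \<Rightarrow> fdds" where
  "table_fdds t = abs_fdds ({..<length t}, \<lambda>u. t ! u)"

lemma is_table_of_iff: "is_table_of t A \<longleftrightarrow> closed_table t \<and> A = table_fdds t"
  by (auto simp: is_table_of_def closed_table_def table_fdds_def)

lemma is_fdds_table: "closed_table t \<Longrightarrow> is_fdds ({..<length t}, \<lambda>u. t ! u)"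
  by (auto simp: is_fdds_def closed_table_def)

lemma fix_count_table_fdds: "closed_table t \<Longrightarrow> fix_count n (table_fdds t) = table_fix_count n t"
  by (simp add: table_fdds_def fix_count_abs_fdds is_fdds_table table_fix_count_def fixed_points_def)

lemma num_states_table_fdds: "closed_table t \<Longrightarrow> num_states (table_fdds t) = length t"
  by (simp add: table_fdds_def num_states_abs_fdds is_fdds_table)

lemma table_fdds_Nil: "table_fdds [] = 0"
  using num_states_table_fdds[of "[]"] by (simp add: num_states_eq_0_iff closed_table_def)

lemma closed_table_append_cycle:
  assumes "closed_table xs"
  shows "closed_table (xs @ cycle_table (length xs) n)"
  using assms by (auto simp: closed_table_def cycle_table_def intro: trans_less_add1)

text \<open>Old and new states form two closed blocks, and shifting by \<open>length xs\<close>
  identifies the new block with \<open>cycle_graph n\<close>.\<close>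

lemma table_fdds_append_cycle:
  assumes xs: "closed_table xs" and n: "0 < n"
  shows "table_fdds (xs @ cycle_table (length xs) n) = table_fdds xs + cycle n"
proof -
  let ?ys = "xs @ cycle_table (length xs) n" and ?l = "length xs"
  let ?G = "({..<?l + n}, \<lambda>u. ?ys ! u)"
  have low: "?ys ! u = xs ! u" if "u < ?l" for u
    using that by (simp add: nth_append)
  have high: "?ys ! u = ?l + Suc (u - ?l) mod n" if "?l \<le> u" "u < ?l + n" for u
  proof -
    have "u - ?l < n" using that by linarith
    then show ?thesis using that(1) by (simp add: nth_append cycle_table_def)
  qed
  have lx: "length ?ys = ?l + n" by (simp add: cycle_table_def)
  have "is_fdds ?G" using is_fdds_table[OF closed_table_append_cycle[OF xs, of n]] lx by simp
  then have "abs_fdds ?G = abs_fdds ({..<?l}, snd ?G) + abs_fdds ({?l..<?l + n}, snd ?G)"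
    by (rule abs_fdds_partition) (use xs low high n in \<open>auto simp: closed_table_def\<close>)
  moreover have "abs_fdds ({..<?l}, snd ?G) = table_fdds xs"
    unfolding table_fdds_def
    by (rule abs_fdds_eqI[symmetric, OF is_fdds_table[OF xs]], rule isomI[where h = id and g = id])
      (use xs low in \<open>auto simp: closed_table_def\<close>)
  moreover have "abs_fdds ({?l..<?l + n}, snd ?G) = cycle n"
    unfolding cycle_def
    by (rule abs_fdds_eqI[symmetric, OF is_fdds_cycle_graph],
        rule isomI[where h = "\<lambda>u. ?l + u" and g = "\<lambda>u. u - ?l"])
      (use high in \<open>auto simp: cycle_graph_def cycle_table_def\<close>)
  ultimately show ?thesis unfolding table_fdds_def[of ?ys] lx by simp
qed

text \<open>The arbitrary tail \<open>r\<close> is carried through the induction in order to locate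
  the table of \<open>B\<close> behind the coefficients.\<close>

lemma poly_at_encoded:
  assumes "\<And>k. k < length (concat (map (\<lambda>(i, t). i # encode_table t) ts) @ r) \<Longrightarrow>
    f (q + k) = (concat (map (\<lambda>(i, t). i # encode_table t) ts) @ r) ! k"
  shows "poly_at f q ts \<and> (\<forall>k<length r. f (poly_end q ts + k) = r ! k)"
  using assms
proof (induction ts arbitrary: q)
  case Nil
  then show ?case by (simp add: poly_end_def)
next
  case (Cons a ts)
  obtain i t where a: "a = (i, t)" by (cases a)
  let ?v = "concat (map (\<lambda>(i, t). i # encode_table t) ts) @ r"
  have f: "f (q + k) = (i # length t # t @ ?v) ! k" if "k < 2 + length t + length ?v" for k
    using Cons.prems[of k] that by (simp add: a encode_table_def)
  have "f (q + 2 + length t + k) = ?v ! k" if "k < length ?v" for k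
    using f[of "2 + length t + k"] that by (simp add: nth_append algebra_simps)
  then have "poly_at f (q + 2 + length t) ts \<and>
      (\<forall>k<length r. f (poly_end (q + 2 + length t) ts + k) = r ! k)"
    by (rule Cons.IH)
  moreover have "f q = i" using f[of 0] by simp
  moreover have "table_at f (q + 1) t"
    unfolding table_at_def
  proof (intro conjI allI impI)
    show "f (q + 1) = length t" using f[of 1] by simp
    show "f (q + 1 + 1 + k) = t ! k" if "k < length t" for k
      using f[of "2 + k"] that by (simp add: nth_append)
  qed
  ultimately show ?case by (simp add: a poly_end_def algebra_simps)
qed

section \<open>The greedy algorithm\<close>

text \<open>The truncated difference is nonzero exactly if \<open>e < c\<close>, that is, while the
  polynomial's count lies below that of \<open>B\<close>. Probing again refreshes both
  scalars.\<close>

definition extend_prog :: program where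
  "extend_prog = While (Sub (var ''c'') (var ''e'')) (Seq add_cycle_prog probe_prog)"

text \<open>Cell 0 of the input holds \<open>L\<close>; the added 1 makes the guard true for
  \<open>n = L\<close> as well.\<close>

definition sizes_left :: expr where
  "sizes_left = Sub (Add (Read ''input'' (Const 0)) (Const 1)) (var ''n'')"

definition greedy_prog :: program where
  "greedy_prog = Seq (assign ''n'' (Const 1))
    (While sizes_left (Seq probe_prog (Seq extend_prog (increment ''n''))))"

text \<open>Unlike the search, the check starts at \<open>n = 0\<close>, which compares the numbers
  of states.\<close>

definition verify_prog :: program where
  "verify_prog = Seq (Seq (assign ''o'' (Const 1)) (assign ''n'' (Const 0)))
    (While sizes_left (Seq probe_prog
      (Seq (Cond (Add (Sub (var ''c'') (var ''e'')) (Sub (var ''e'') (var ''c'')))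
          (assign ''o'' (Const 0)) Skip)
        (increment ''n''))))"

text \<open>The candidate already stands at cell 2 with its length word. Only the flag in cell 1 and
  the total length, two more than the number of states, have to be supplied.\<close>

definition answer_prog :: program where
  "answer_prog = Cond (var ''o'')
    (Seq (Write ''output'' (Const 0) (Add (Read ''output'' (Const 2)) (Const 2)))
      (Write ''output'' (Const 1) (Const 1)))
    (Seq (Write ''output'' (Const 0) (Const 1)) (Write ''output'' (Const 1) (Const 0)))"

definition solver_prog :: program where
  "solver_prog = Seq greedy_prog (Seq verify_prog answer_prog)"

lemma writes_extend_prog [simp]:
  "writes extend_prog = {''c'', ''u'', ''v'', ''k'', ''y'', ''g'', ''z'', ''h'', ''e'', ''q'', ''j'', ''i'', ''p'', ''x'', ''output'', ''l''}"
  by (auto simp: extend_prog_def)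

lemma writes_greedy_prog [simp]:
  "writes greedy_prog = {''c'', ''u'', ''v'', ''k'', ''y'', ''g'', ''z'', ''h'', ''e'', ''q'', ''j'', ''i'', ''p'', ''x'', ''output'', ''l'', ''n''}"
  by (auto simp: greedy_prog_def)

lemma writes_verify_prog [simp]:
  "writes verify_prog = {''c'', ''u'', ''v'', ''k'', ''y'', ''g'', ''z'', ''h'', ''e'', ''q'', ''j'', ''i'', ''p'', ''x'', ''n'', ''o''}"
  by (auto simp: verify_prog_def)

lemma sizes_left_simps [simp]:
  "expr_cost sizes_left = 7" "expr_val sizes_left s = s ''input'' 0 + 1 - s ''n'' 0"
  by (simp_all add: sizes_left_def)

text \<open>The candidate has at most \<open>L * L * L\<close> states: at most \<open>L\<close>
  cycles for each of \<open>L\<close> lengths, each of length at most \<open>L\<close>.\<close>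

definition extend_time :: "nat \<Rightarrow> nat" where
  "extend_time L = L * (L * 40 + probe_time L (L * L * L) + 100) + 10"

definition greedy_time :: "nat \<Rightarrow> nat" where
  "greedy_time L = L * (probe_time L (L * L * L) + extend_time L + 50) + 50"

definition verify_time :: "nat \<Rightarrow> nat" where
  "verify_time L = (L + 1) * (probe_time L (L * L * L) + 100) + 50"

definition solver_time :: "nat \<Rightarrow> nat" where
  "solver_time L = greedy_time L + verify_time L + 50"

locale perm_equation =
  fixes P :: "fdds poly" and B :: fdds and ts :: "(nat \<times> nat list) list" and b :: "nat list"
  assumes perm_coeffs: "\<And>i. is_perm (coeff P i)"
    and injective: "injective_on_perms P"
    and perm_B: "is_perm B"
    and table_P: "is_table_of_poly ts P"
    and table_B: "is_table_of b B"
begin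

section \<open>Input length and the effect of capping exponents\<close>

definition L :: nat where
  "L = length (encode_instance ts b)"

definition solution :: "fdds \<Rightarrow> bool" where
  "solution X \<longleftrightarrow> is_perm X \<and> poly P X = B"

lemma b: "closed_table b" "table_fdds b = B" "length b = num_states B"
  using table_B num_states_table_fdds[of b] by (auto simp: is_table_of_iff)

lemma ts: "(i, t) \<in> set ts \<Longrightarrow> closed_table t \<and> table_fdds t = coeff P i"
  using table_P by (auto simp: is_table_of_poly_def is_table_of_iff)

lemma L_eq: "L = (\<Sum>a\<leftarrow>ts. 2 + length (snd a)) + length b + 2"
proof -
  have "length (concat (map (\<lambda>(i, t). i # encode_table t) ts)) = (\<Sum>a\<leftarrow>ts. 2 + length (snd a))"
    by (induction ts) (auto simp: encode_table_def)
  then show ?thesis by (simp add: L_def encode_instance_def encode_table_def)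
qed

text \<open>The first bound is strict so that every count of \<open>B\<close> lies below the cap, as
  \<open>table_poly_compare\<close> requires.\<close>

lemma length_less_L:
  shows "length b < L" "length ts \<le> L" "a \<in> set ts \<Longrightarrow> length (snd a) \<le> L"
proof -
  show "length b < L" by (simp add: L_eq)
  have "length ts \<le> (\<Sum>a\<leftarrow>ts. 2 + length (snd a))" by (induction ts) auto
  then show "length ts \<le> L" by (simp add: L_eq)
  show "length (snd a) \<le> L" if "a \<in> set ts"
  proof -
    have "2 + length (snd a) \<le> (\<Sum>a\<leftarrow>ts. 2 + length (snd a))"
      using that by (intro member_le_sum_list) auto
    then show ?thesis by (simp add: L_eq)
  qed
qed

lemma distinct_exponents: "distinct (map fst ts)"
  using table_P by (auto simp: is_table_of_poly_def strict_sorted_iff)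

lemma sum_list_ts: "(\<Sum>a\<leftarrow>ts. g a) = (\<Sum>a\<in>set ts. g a)"
  using distinct_exponents by (simp add: sum_list_distinct_conv_sum_set distinct_map)

text \<open>A listed coefficient is nonzero, so it has a state and its two header words cost at most
  twice its size. The remaining 2 stands for the number of coefficients and the length word of
  \<open>B\<close>.\<close>

lemma L_le: "L \<le> 3 * instance_size P B + 2"
proof -
  have inj: "inj_on fst (set ts)" using distinct_exponents by (simp add: distinct_map)
  have img: "fst ` set ts = {i. coeff P i \<noteq> 0}" using table_P by (simp add: is_table_of_poly_def)
  have "2 + length (snd a) \<le> 3 * num_states (coeff P (fst a))" if "a \<in> set ts" for a
  proof -
    have "(fst a, snd a) \<in> set ts" using that by simp
    from ts[OF this] have "length (snd a) = num_states (coeff P (fst a))"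
      using num_states_table_fdds by metis
    moreover have "coeff P (fst a) \<noteq> 0" using that img by blast
    then have "num_states (coeff P (fst a)) \<noteq> 0" by (simp add: num_states_eq_0_iff)
    ultimately show ?thesis by simp
  qed
  then have "(\<Sum>a\<in>set ts. 2 + length (snd a)) \<le> (\<Sum>a\<in>set ts. 3 * num_states (coeff P (fst a)))"
    by (intro sum_mono)
  also have "\<dots> = (\<Sum>i\<in>fst ` set ts. 3 * num_states (coeff P i))"
    using sum.reindex[OF inj, of "\<lambda>i. 3 * num_states (coeff P i)"] by (simp add: comp_def)
  also have "\<dots> \<le> (\<Sum>i\<le>degree P. 3 * num_states (coeff P i))"
    unfolding img by (rule sum_mono2) (auto intro: le_degree)
  finally have "(\<Sum>a\<in>set ts. 2 + length (snd a)) \<le> 3 * (\<Sum>i\<le>degree P. num_states (coeff P i))"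
    by (simp add: sum_distrib_left)
  then show ?thesis by (simp add: L_eq sum_list_ts b instance_size_def)
qed

lemma table_poly_eq: "table_poly L n x ts = (\<Sum>i\<le>degree P. fix_count n (coeff P i) * x ^ min i L)"
proof -
  have inj: "inj_on fst (set ts)" using distinct_exponents by (simp add: distinct_map)
  have img: "fst ` set ts = {i. coeff P i \<noteq> 0}" using table_P by (simp add: is_table_of_poly_def)
  have "table_poly L n x ts = (\<Sum>a\<in>set ts. table_fix_count n (snd a) * x ^ min (fst a) L)"
    by (simp add: table_poly_def sum_list_ts)
  also have "\<dots> = (\<Sum>a\<in>set ts. fix_count n (coeff P (fst a)) * x ^ min (fst a) L)"
  proof (rule sum.cong)
    fix a assume "a \<in> set ts"
    then have "(fst a, snd a) \<in> set ts" by simp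
    from ts[OF this] show "table_fix_count n (snd a) * x ^ min (fst a) L =
        fix_count n (coeff P (fst a)) * x ^ min (fst a) L"
      using fix_count_table_fdds by metis
  qed simp
  also have "\<dots> = (\<Sum>i\<in>fst ` set ts. fix_count n (coeff P i) * x ^ min i L)"
    using sum.reindex[OF inj, of "\<lambda>i. fix_count n (coeff P i) * x ^ min i L"] by (simp add: comp_def)
  also have "\<dots> = (\<Sum>i\<le>degree P. fix_count n (coeff P i) * x ^ min i L)"
    unfolding img by (rule sum.mono_neutral_left) (auto intro: le_degree)
  finally show ?thesis .
qed

text \<open>Capping can change a term only if \<open>i > L\<close>, the coefficient count is
  positive and \<open>x \<ge> 2\<close>. Then the capped and the true value are both at least
  \<open>2 ^ L\<close>, hence beyond \<open>c\<close>.\<close>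

lemma table_poly_compare:
  assumes "c < L"
  shows "table_poly L n x ts < c \<longleftrightarrow> count_poly P n x < c"
    and "table_poly L n x ts = c \<longleftrightarrow> count_poly P n x = c"
proof -
  have "table_poly L n x ts = count_poly P n x \<or> L \<le> table_poly L n x ts \<and> L \<le> count_poly P n x"
  proof (cases "\<exists>i\<le>degree P. L < i \<and> 0 < fix_count n (coeff P i) \<and> 2 \<le> x")
    case True
    then obtain i where i: "i \<le> degree P" "L < i" "0 < fix_count n (coeff P i)" "2 \<le> x" by blast
    have "L \<le> 2 ^ L" by (simp add: less_imp_le)
    also have "(2::nat) ^ L \<le> x ^ L" using i(4) by (rule power_mono) simp
    finally have *: "L \<le> x ^ L" .
    also have "x ^ L \<le> x ^ i" using i by (intro power_increasing) auto
    finally have **: "L \<le> x ^ i" .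
    have "x ^ k \<le> fix_count n (coeff P i) * x ^ k" for k using i(3) by simp
    then have "L \<le> fix_count n (coeff P i) * x ^ min i L" "L \<le> fix_count n (coeff P i) * x ^ i"
      using * ** i(2) by (metis le_trans min.absorb2 less_imp_le)+
    moreover have "fix_count n (coeff P i) * x ^ min i L \<le> table_poly L n x ts"
      unfolding table_poly_eq
      by (rule member_le_sum[where f = "\<lambda>i. fix_count n (coeff P i) * x ^ min i L"]) (use i in auto)
    moreover have "fix_count n (coeff P i) * x ^ i \<le> count_poly P n x"
      unfolding count_poly_def
      by (rule member_le_sum[where f = "\<lambda>i. fix_count n (coeff P i) * x ^ i"]) (use i in auto)
    ultimately show ?thesis by simp
  next
    case False
    have "fix_count n (coeff P i) * x ^ min i L = fix_count n (coeff P i) * x ^ i"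
      if "i \<le> degree P" for i
    proof (cases "i \<le> L \<or> fix_count n (coeff P i) = 0")
      case neither: False
      then have "x = 0 \<or> x = 1" using False that by (auto simp: not_le)
      \<comment> \<open>For \<open>x = 0\<close> both powers vanish because the capped exponent is
        still positive: \<open>c < L\<close> gives \<open>L > 0\<close>.\<close>
      then show ?thesis using assms neither by (auto simp: power_0_left)
    qed auto
    then have "table_poly L n x ts = count_poly P n x"
      unfolding table_poly_eq count_poly_def by (intro sum.cong) auto
    then show ?thesis ..
  qed
  then show "table_poly L n x ts < c \<longleftrightarrow> count_poly P n x < c"
    and "table_poly L n x ts = c \<longleftrightarrow> count_poly P n x = c"
    using assms by auto
qed

section \<open>The invariant of the greedy search\<close>

definition below :: "nat \<Rightarrow> nat list \<Rightarrow> bool" where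
  "below n xs \<longleftrightarrow> fix_count n (poly P (table_fdds xs)) < fix_count n B"

definition meets :: "nat \<Rightarrow> nat list \<Rightarrow> bool" where
  "meets n xs \<longleftrightarrow> fix_count n (poly P (table_fdds xs)) = fix_count n B"

lemma input_layout:
  assumes "s ''input'' = init_store (encode_instance ts b) ''input''"
  shows "s ''input'' 0 = L" "s ''input'' 1 = length ts" "poly_at (s ''input'') 2 ts"
    "table_at (s ''input'') (poly_end 2 ts) b"
proof -
  let ?w = "encode_instance ts b"
  have cell: "s ''input'' (Suc k) = ?w ! k" if "k < length ?w" for k
    using that by (simp add: assms init_store_def)
  show "s ''input'' 0 = L" by (simp add: assms init_store_def L_def)
  show "s ''input'' 1 = length ts" using cell[of 0] by (simp add: encode_instance_def)
  have "poly_at (s ''input'') 2 ts \<and>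
      (\<forall>k<length (encode_table b). s ''input'' (poly_end 2 ts + k) = encode_table b ! k)"
    by (rule poly_at_encoded) (use cell[of "Suc _"] in \<open>simp add: encode_instance_def\<close>)
  then have *: "poly_at (s ''input'') 2 ts"
    "\<And>k. k < length (encode_table b) \<Longrightarrow> s ''input'' (poly_end 2 ts + k) = encode_table b ! k"
    by auto
  show "poly_at (s ''input'') 2 ts" by (fact *)
  show "table_at (s ''input'') (poly_end 2 ts) b"
    using *(2)[of 0] *(2)[of "Suc _"] by (simp add: table_at_def encode_table_def)
qed

lemma runs_probe:
  assumes inp: "s ''input'' = init_store (encode_instance ts b) ''input''"
    and xs: "table_at (s ''output'') 2 xs" "closed_table xs" "length xs \<le> X"
    and n: "s ''n'' 0 \<le> L"
  shows "runs probe_prog s (probe_time L X)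
    (\<lambda>s'. (s' ''e'' 0 < s' ''c'' 0 \<longleftrightarrow> below (s ''n'' 0) xs) \<and> (s' ''e'' 0 = s' ''c'' 0 \<longleftrightarrow> meets (s ''n'' 0) xs))"
proof -
  let ?n = "s ''n'' 0"
  have c: "table_fix_count ?n b = fix_count ?n B" "table_fix_count ?n b < L"
    using fix_count_table_fdds[OF b(1), of ?n] b(2) table_fix_count_le[of ?n b] length_less_L(1) by auto
  have x: "table_fix_count ?n xs = fix_count ?n (table_fdds xs)"
    using fix_count_table_fdds[OF xs(2)] by simp
  have "runs probe_prog s (probe_time L X)
    (\<lambda>s'. s' ''e'' 0 = table_poly L (s ''n'' 0) (table_fix_count (s ''n'' 0) xs) ts \<and>
      s' ''c'' 0 = table_fix_count (s ''n'' 0) b)"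
    by (rule runs_probe_prog[where s = s, OF input_layout[of s, OF inp]])
      (use ts length_less_L b(1) xs n in \<open>auto intro: less_imp_le\<close>)
  then show ?thesis
    by (rule runs_weaken)
      (use table_poly_compare[OF c(2)] c(1) x in \<open>auto simp: below_def meets_def fix_count_poly\<close>)
qed

text \<open>The remainder \<open>R\<close> stands for what a solution still lacks. Quantifying over
  all solutions lets the invariant hold also when there is none. The count at 0 is left out because
  it is the size of \<open>R\<close>.\<close>

definition partial_solution :: "nat \<Rightarrow> nat list \<Rightarrow> bool" where
  "partial_solution n xs \<longleftrightarrow> closed_table xs \<and> is_perm (table_fdds xs) \<and>
    (\<forall>X. solution X \<longrightarrow> (\<exists>R. is_perm R \<and> X = table_fdds xs + R \<and>
      (\<forall>k. 0 < k \<longrightarrow> k < n \<longrightarrow> fix_count k R = 0)))"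

lemma partial_solution_Nil: "partial_solution 1 []"
  by (auto simp: partial_solution_def closed_table_def table_fdds_Nil solution_def)

text \<open>By strict monotonicity a solution has a larger count at \<open>n\<close> than the
  candidate, so \<open>R\<close> has a positive count there and none at smaller positive arguments.
  Hence an \<open>n\<close>-cycle splits off from \<open>R\<close>.\<close>

lemma partial_solution_add_cycle:
  assumes xs: "partial_solution n xs" "below n xs" and n: "0 < n"
  shows "partial_solution n (xs @ cycle_table (length xs) n)"
  unfolding partial_solution_def
proof (intro conjI allI impI)
  have closed: "closed_table xs" and perm: "is_perm (table_fdds xs)"
    using xs(1) by (auto simp: partial_solution_def)
  show "closed_table (xs @ cycle_table (length xs) n)" by (rule closed_table_append_cycle[OF closed])
  show "is_perm (table_fdds (xs @ cycle_table (length xs) n))"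
    unfolding table_fdds_append_cycle[OF closed n] by (intro is_perm_add perm is_perm_cycle n)
  fix X assume X: "solution X"
  then obtain R where R: "is_perm R" "X = table_fdds xs + R"
    "\<And>k. 0 < k \<Longrightarrow> k < n \<Longrightarrow> fix_count k R = 0"
    using xs(1) by (auto simp: partial_solution_def)
  have "count_poly P n (fix_count n (table_fdds xs)) < count_poly P n (fix_count n X)"
    using xs(2) X by (auto simp: below_def solution_def simp flip: fix_count_poly)
  then have "0 < fix_count n R"
    using count_poly_less_iff[OF perm_coeffs injective] R(2) by simp
  then obtain R' where "is_perm R'" "R = cycle n + R'"
    using split_cycle[OF R(1) n] R(3) by blast
  then show "\<exists>R. is_perm R \<and> X = table_fdds (xs @ cycle_table (length xs) n) + R \<and>
      (\<forall>k. 0 < k \<longrightarrow> k < n \<longrightarrow> fix_count k R = 0)"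
    using R unfolding table_fdds_append_cycle[OF closed n]
    by (intro exI[of _ R']) (auto simp: add.assoc)
qed

text \<open>Without a deficit the count of a solution at \<open>n\<close> cannot exceed that of the
  candidate it contains, so nothing is left for \<open>R\<close> at \<open>n\<close>.\<close>

lemma partial_solution_Suc:
  assumes xs: "partial_solution n xs" "\<not> below n xs"
  shows "partial_solution (Suc n) xs"
  unfolding partial_solution_def
proof (intro conjI allI impI)
  show "closed_table xs" "is_perm (table_fdds xs)" using xs(1) by (auto simp: partial_solution_def)
  fix X assume X: "solution X"
  then obtain R where R: "is_perm R" "X = table_fdds xs + R"
    "\<And>k. 0 < k \<Longrightarrow> k < n \<Longrightarrow> fix_count k R = 0"
    using xs(1) by (auto simp: partial_solution_def)
  have "\<not> count_poly P n (fix_count n (table_fdds xs)) < count_poly P n (fix_count n X)"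
    using xs(2) X by (auto simp: below_def solution_def simp flip: fix_count_poly)
  then have "fix_count n R = 0"
    using count_poly_less_iff[OF perm_coeffs injective] R(2) by simp
  then show "\<exists>R. is_perm R \<and> X = table_fdds xs + R \<and> (\<forall>k. 0 < k \<longrightarrow> k < Suc n \<longrightarrow> fix_count k R = 0)"
    using R by (intro exI[of _ R]) (auto simp: less_Suc_eq)
qed

text \<open>Bounds the number of rounds: each added \<open>n\<close>-cycle raises this count. No
  solution has to exist for the bound.\<close>

lemma below_imp_less:
  assumes "below n xs"
  shows "fix_count n (table_fdds xs) < L"
proof -
  have "fix_count n (table_fdds xs) \<le> count_poly P n (fix_count n (table_fdds xs))"
    by (rule count_poly_ge[OF perm_coeffs injective])
  also have "\<dots> < fix_count n B" using assms by (simp add: below_def fix_count_poly)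
  also have "\<dots> \<le> num_states B" by (rule fix_count_le)
  finally show ?thesis using length_less_L(1) b(3) by simp
qed

text \<open>At \<open>n = 0\<close>, \<open>count_poly_ge\<close> says that a solution is no larger
  than \<open>B\<close>. So \<open>R\<close> has fewer than \<open>L\<close> states, and a nonzero
  \<open>R\<close> would have a positive count at some positive length already settled.\<close>

lemma complete_partial_solution:
  assumes "partial_solution (Suc L) xs" "solution X"
  shows "X = table_fdds xs"
proof -
  obtain R where R: "is_perm R" "X = table_fdds xs + R"
    "\<And>k. 0 < k \<Longrightarrow> k < Suc L \<Longrightarrow> fix_count k R = 0"
    using assms by (auto simp: partial_solution_def)
  have "num_states R \<le> num_states X" by (simp add: R(2) flip: fix_count_0)
  also have "\<dots> \<le> count_poly P 0 (fix_count 0 X)"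
    using count_poly_ge[OF perm_coeffs injective] by (simp add: fix_count_0)
  also have "\<dots> = fix_count 0 (poly P X)" by (simp add: fix_count_poly)
  also have "\<dots> = num_states B" using assms(2) by (simp add: solution_def fix_count_0)
  finally have size: "num_states R \<le> L" using length_less_L(1) b(3) by simp
  have "R = 0"
  proof (rule ccontr)
    assume "R \<noteq> 0"
    then obtain n where "0 < n" "n \<le> num_states R" "0 < fix_count n R"
      using nonzero_perm_has_cycle[OF R(1)] by metis
    then show False using R(3)[of n] size by simp
  qed
  then show ?thesis using R(2) by simp
qed

text \<open>The equation at 0 makes the sizes equal, hence both at most \<open>L\<close>, and then
  the counts up to \<open>L\<close> decide equality of permutations.\<close>

lemma solution_iff_meets:
  assumes "is_perm (table_fdds xs)"
  shows "solution (table_fdds xs) \<longleftrightarrow> (\<forall>n\<le>L. meets n xs)"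
proof
  assume m: "\<forall>n\<le>L. meets n xs"
  have size: "num_states (poly P (table_fdds xs)) = num_states B"
    using m by (auto simp: meets_def simp flip: fix_count_0)
  have "poly P (table_fdds xs) = B"
    by (rule perm_eqI[where N = L])
      (use assms m size b(3) length_less_L(1) in \<open>auto intro: is_perm_poly perm_coeffs perm_B simp: meets_def\<close>)
  then show "solution (table_fdds xs)" using assms by (simp add: solution_def)
qed (simp add: solution_def meets_def)

section \<open>Correctness and running time of the solver\<close>

lemma runs_extend_prog:
  assumes inp: "s ''input'' = init_store (encode_instance ts b) ''input''"
    and n: "0 < s ''n'' 0" "s ''n'' 0 \<le> L"
    and xs: "table_at (s ''output'') 2 xs" "partial_solution (s ''n'' 0) xs"
      "length xs + L * L \<le> s ''n'' 0 * (L * L)"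
    and e: "s ''e'' 0 < s ''c'' 0 \<longleftrightarrow> below (s ''n'' 0) xs"
  shows "runs extend_prog s (extend_time L) (\<lambda>s'. \<exists>ys. table_at (s' ''output'') 2 ys \<and>
    partial_solution (Suc (s ''n'' 0)) ys \<and> length ys \<le> s ''n'' 0 * (L * L))"
proof -
  let ?n = "s ''n'' 0"
  \<comment> \<open>\<open>m\<close> is the number of cycles that may still be added, initially
    \<open>L\<close>. A round lengthens the table by \<open>?n \<le> L\<close> and raises the count
    at \<open>?n\<close> by \<open>?n \<ge> 1\<close>, so the conditions on length and count both
    survive when \<open>m\<close> drops by one.\<close>
  let ?I = "\<lambda>m s'. \<exists>ys. table_at (s' ''output'') 2 ys \<and> partial_solution ?n ys \<and>
    length ys + m * L \<le> ?n * (L * L) \<and> L \<le> m + fix_count ?n (table_fdds ys) \<and>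
    (s' ''e'' 0 < s' ''c'' 0 \<longleftrightarrow> below ?n ys)"
  let ?e = "Sub (var ''c'') (var ''e'')"
  have cost: "expr_cost ?e = 5" by simp
  let ?T = "1 + (?n * 40 + 60) + probe_time L (L * L * L)"
  have "runs extend_prog s (L * (1 + 5 + ?T) + 1 + 5) (\<lambda>s'. expr_val ?e s' = 0 \<and> (\<exists>m. ?I m s'))"
    unfolding extend_prog_def
  proof (rule runs_While_variant[where e = ?e, unfolded cost], goal_cases)
    case 1
    show ?case using xs e by (intro exI[of _ xs]) auto
  next
    case (2 m s')
    then obtain ys where ys: "table_at (s' ''output'') 2 ys" "partial_solution ?n ys"
      "length ys + m * L \<le> ?n * (L * L)" "L \<le> m + fix_count ?n (table_fdds ys)" "below ?n ys"
      by auto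
    have frame: "s' ''input'' = s ''input''" "s' ''n'' = s ''n''"
      using 2(3) by simp_all
    have closed: "closed_table ys" using ys(2) by (simp add: partial_solution_def)
    \<comment> \<open>A deficit keeps the count below \<open>L\<close>, so the condition on the
      count leaves \<open>m\<close> positive.\<close>
    obtain m' where m': "m = Suc m'"
      using below_imp_less[OF ys(5)] ys(4) by (cases m) auto
    let ?zs = "ys @ cycle_table (length ys) ?n"
    have zs: "partial_solution ?n ?zs" by (rule partial_solution_add_cycle[OF ys(2,5) n(1)])
    then have closed': "closed_table ?zs" by (simp add: partial_solution_def)
    have "fix_count ?n (table_fdds ?zs) = fix_count ?n (table_fdds ys) + ?n"
      using n(1) by (simp add: table_fdds_append_cycle[OF closed n(1)] fix_count_cycle)
    then have fuel: "L \<le> m' + fix_count ?n (table_fdds ?zs)" using ys(4) m' n(1) by simp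
    have len: "length ?zs + m' * L \<le> ?n * (L * L)"
      using ys(3) m' n(2) by (simp add: cycle_table_def)
    also have "\<dots> \<le> L * (L * L)" using n(2) by (rule mult_le_mono1)
    finally have short: "length ?zs \<le> L * L * L" by (simp add: mult.assoc)
    have "runs (Seq add_cycle_prog probe_prog) s' ?T (?I m')"
    proof (rule runs_Seq[where R = "\<lambda>s1. table_at (s1 ''output'') 2 ?zs"], goal_cases)
      case 1
      have "runs add_cycle_prog s' (s' ''n'' 0 * 40 + 60)
        (\<lambda>s1. table_at (s1 ''output'') 2 (ys @ cycle_table (length ys) (s' ''n'' 0)))"
        by (rule runs_add_cycle_prog) (use ys(1) frame n in auto)
      then show ?case using frame by simp
    next
      case (2 s1)
      have s1: "s1 ''input'' = s ''input''" "s1 ''n'' = s ''n''" using 2(2) frame by simp_all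
      have "runs probe_prog s1 (probe_time L (L * L * L))
        (\<lambda>s2. (s2 ''e'' 0 < s2 ''c'' 0 \<longleftrightarrow> below (s1 ''n'' 0) ?zs) \<and> (s2 ''e'' 0 = s2 ''c'' 0 \<longleftrightarrow> meets (s1 ''n'' 0) ?zs))"
        by (rule runs_probe) (use s1 inp 2(1) closed' short n in auto)
      then show ?case
      proof (rule runs_weaken)
        fix s2 assume s2: "(s2 ''e'' 0 < s2 ''c'' 0 \<longleftrightarrow> below (s1 ''n'' 0) ?zs) \<and> (s2 ''e'' 0 = s2 ''c'' 0 \<longleftrightarrow> meets (s1 ''n'' 0) ?zs)"
          and f: "\<And>a. a \<notin> writes probe_prog \<Longrightarrow> s2 a = s1 a"
        have "s2 ''output'' = s1 ''output''" using f by simp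
        then show "?I m' s2"
          using s2 s1 2(1) zs fuel len by (intro exI[of _ ?zs]) auto
      qed simp
    qed
    then show ?case using m' by blast
  qed
  then show ?thesis
  proof (rule runs_weaken)
    have "1 + 5 + ?T \<le> L * 40 + probe_time L (L * L * L) + 100" using n(2) by simp
    then have "L * (1 + 5 + ?T) \<le> L * (L * 40 + probe_time L (L * L * L) + 100)" by (rule mult_le_mono2)
    then show "L * (1 + 5 + ?T) + 1 + 5 \<le> extend_time L" unfolding extend_time_def by linarith
  next
    fix s' assume "expr_val ?e s' = 0 \<and> (\<exists>m. ?I m s')"
    then obtain m ys where "s' ''c'' 0 \<le> s' ''e'' 0" "table_at (s' ''output'') 2 ys" "partial_solution ?n ys"
      "length ys + m * L \<le> ?n * (L * L)" "s' ''e'' 0 < s' ''c'' 0 \<longleftrightarrow> below ?n ys"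
      by auto
    then show "\<exists>ys. table_at (s' ''output'') 2 ys \<and> partial_solution (Suc ?n) ys \<and> length ys \<le> ?n * (L * L)"
      using partial_solution_Suc by (intro exI[of _ ys]) auto
  qed
qed

lemma runs_greedy_prog:
  assumes inp: "s ''input'' = init_store (encode_instance ts b) ''input''"
    and out: "table_at (s ''output'') 2 []"
  shows "runs greedy_prog s (greedy_time L) (\<lambda>s'. \<exists>xs. table_at (s' ''output'') 2 xs \<and>
    partial_solution (Suc L) xs \<and> length xs \<le> L * L * L)"
proof -
  \<comment> \<open>Each finished length is granted \<open>L * L\<close> cells, enough for
    \<open>L\<close> cycles of at most \<open>L\<close> states.\<close>
  let ?J = "\<lambda>k s'. \<exists>xs. table_at (s' ''output'') 2 xs \<and> partial_solution (Suc k) xs \<and> length xs \<le> k * (L * L)"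
  let ?I = "\<lambda>k s'. s' ''n'' 0 = Suc k \<and> ?J k s'"
  let ?T = "1 + probe_time L (L * L * L) + (1 + extend_time L + 10)"
  have cost: "expr_cost sizes_left = 7" by simp
  have "runs greedy_prog s (1 + 10 + (L * (1 + 7 + ?T) + 1 + 7)) (?I L)"
    unfolding greedy_prog_def
  proof (rule runs_Seq[where R = "?I 0"], goal_cases)
    case 1
    show ?case
      by (rule runs_loop_free) (use out partial_solution_Nil in \<open>auto intro!: exI[of _ "[]"]\<close>)
  next
    case (2 s1)
    show ?case
    proof (rule runs_While_count[where e = sizes_left and I = ?I and n = L, unfolded cost], goal_cases)
      case 1
      show ?case using 2 by blast
    next
      case (2 k s2)
      have inp2: "s2 ''input'' = s ''input''" using 2(2) \<open>\<And>a. a \<notin> _ \<Longrightarrow> s1 a = s a\<close> by simp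
      then have L2: "s2 ''input'' 0 = L" using input_layout(1)[of s, OF inp] by simp
      obtain xs where xs: "table_at (s2 ''output'') 2 xs" "partial_solution (Suc k) xs" "length xs \<le> k * (L * L)"
        using 2(1) by blast
      have nk: "s2 ''n'' 0 = Suc k" using 2(1) by blast
      have kL: "Suc k \<le> L" using 2(3) by simp
      have "k * (L * L) \<le> L * (L * L)" using 2(3) by (intro mult_le_mono1) simp
      then have short: "length xs \<le> L * L * L" using le_trans[OF xs(3)] by (simp only: mult.assoc)
      have closed: "closed_table xs" using xs(2) by (simp add: partial_solution_def)
      have "runs (Seq probe_prog (Seq extend_prog (increment ''n''))) s2 ?T (?I (Suc k))"
      proof (rule runs_Seq[where R = "\<lambda>s3. s3 ''n'' 0 = Suc k \<and> s3 ''input'' = s ''input'' \<and>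
            table_at (s3 ''output'') 2 xs \<and> (s3 ''e'' 0 < s3 ''c'' 0 \<longleftrightarrow> below (Suc k) xs)"], goal_cases)
        case 1
        have "runs probe_prog s2 (probe_time L (L * L * L))
          (\<lambda>s3. (s3 ''e'' 0 < s3 ''c'' 0 \<longleftrightarrow> below (s2 ''n'' 0) xs) \<and> (s3 ''e'' 0 = s3 ''c'' 0 \<longleftrightarrow> meets (s2 ''n'' 0) xs))"
          by (rule runs_probe) (use inp2 inp xs(1) closed short nk kL in auto)
        then show ?case
          by (rule runs_weaken) (use inp2 nk xs(1) in auto)
      next
        case (2 s3)
        have s3: "s3 ''n'' 0 = Suc k" "s3 ''input'' = s ''input''" "table_at (s3 ''output'') 2 xs"
          "s3 ''e'' 0 < s3 ''c'' 0 \<longleftrightarrow> below (Suc k) xs"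
          using 2(1) by blast+
        show ?case
        proof (rule runs_Seq[where R = "\<lambda>s4. s4 ''n'' 0 = Suc k \<and> ?J (Suc k) s4"], goal_cases)
          case 1
          have "runs extend_prog s3 (extend_time L) (\<lambda>s'. \<exists>ys. table_at (s' ''output'') 2 ys \<and>
              partial_solution (Suc (s3 ''n'' 0)) ys \<and> length ys \<le> s3 ''n'' 0 * (L * L))"
            by (rule runs_extend_prog[where xs = xs]) (use s3 inp xs kL in auto)
          then show ?case
          proof (rule runs_weaken)
            fix s4 assume s4: "\<exists>ys. table_at (s4 ''output'') 2 ys \<and>
              partial_solution (Suc (s3 ''n'' 0)) ys \<and> length ys \<le> s3 ''n'' 0 * (L * L)"
              and f: "\<And>a. a \<notin> writes extend_prog \<Longrightarrow> s4 a = s3 a"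
            have "s4 ''n'' = s3 ''n''" using f by simp
            then show "s4 ''n'' 0 = Suc k \<and> ?J (Suc k) s4" using s4 s3(1) by simp
          qed simp
        next
          case (2 s4)
          show ?case by (rule runs_loop_free) (use 2(1) in auto)
        qed
      qed
      then show ?case using nk L2 kL by simp
    next
      case (3 s2)
      have "s2 ''input'' = s ''input''" using 3(2) \<open>\<And>a. a \<notin> _ \<Longrightarrow> s1 a = s a\<close> by simp
      then show ?case using 3(1) input_layout(1)[of s, OF inp] by auto
    qed
  qed
  then show ?thesis
  proof (rule runs_weaken)
    show "1 + 10 + (L * (1 + 7 + ?T) + 1 + 7) \<le> greedy_time L"
      unfolding greedy_time_def by (simp add: algebra_simps)
  qed (auto simp: mult.assoc)
qed

lemma runs_verify_prog:
  assumes inp: "s ''input'' = init_store (encode_instance ts b) ''input''"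
    and xs: "table_at (s ''output'') 2 xs" "closed_table xs" "length xs \<le> L * L * L"
  shows "runs verify_prog s (verify_time L) (\<lambda>s'. s' ''o'' 0 \<noteq> 0 \<longleftrightarrow> (\<forall>n\<le>L. meets n xs))"
proof -
  let ?I = "\<lambda>k s'. s' ''n'' 0 = k \<and> (s' ''o'' 0 \<noteq> 0 \<longleftrightarrow> (\<forall>n<k. meets n xs))"
  let ?T = "1 + probe_time L (L * L * L) + 40"
  have cost: "expr_cost sizes_left = 7" by simp
  have "runs verify_prog s (1 + 10 + (Suc L * (1 + 7 + ?T) + 1 + 7)) (?I (Suc L))"
    unfolding verify_prog_def
  proof (rule runs_Seq[where R = "?I 0"], goal_cases)
    case 1
    show ?case by (rule runs_loop_free) auto
  next
    case (2 s1)
    have frame1: "s1 ''input'' = s ''input''" "s1 ''output'' = s ''output''" using 2(2) by simp_all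
    show ?case
    proof (rule runs_While_count[where e = sizes_left and I = ?I and n = "Suc L", unfolded cost], goal_cases)
      case 1
      show ?case using 2 by blast
    next
      case (2 k s2)
      have frame: "s2 ''input'' = s ''input''" "s2 ''output'' = s ''output''"
        using 2(2) frame1 by simp_all
      have L2: "s2 ''input'' 0 = L" using frame input_layout(1)[of s, OF inp] by simp
      have "runs (Seq probe_prog
        (Seq (Cond (Add (Sub (var ''c'') (var ''e'')) (Sub (var ''e'') (var ''c'')))
            (assign ''o'' (Const 0)) Skip)
          (increment ''n''))) s2 ?T (?I (Suc k))"
      proof (rule runs_Seq[where R = "\<lambda>s3. ?I k s3 \<and> (s3 ''e'' 0 = s3 ''c'' 0 \<longleftrightarrow> meets k xs)"], goal_cases)
        case 1
        have "runs probe_prog s2 (probe_time L (L * L * L))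
          (\<lambda>s3. (s3 ''e'' 0 < s3 ''c'' 0 \<longleftrightarrow> below (s2 ''n'' 0) xs) \<and> (s3 ''e'' 0 = s3 ''c'' 0 \<longleftrightarrow> meets (s2 ''n'' 0) xs))"
          by (rule runs_probe) (use frame inp xs 2 in auto)
        then show ?case by (rule runs_weaken) (use 2(1) in auto)
      next
        case (2 s3)
        have "(\<forall>m<Suc k. meets m xs) \<longleftrightarrow> (\<forall>m<k. meets m xs) \<and> meets k xs"
          by (auto simp: less_Suc_eq)
        moreover have "s3 ''c'' 0 - s3 ''e'' 0 + (s3 ''e'' 0 - s3 ''c'' 0) = 0 \<longleftrightarrow> meets k xs"
          using 2(1) by auto
        ultimately show ?case
          by (intro runs_loop_free) (use 2(1) in simp_all)
      qed
      then show ?case using 2(1,3) L2 by simp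
    next
      case (3 s2)
      have "s2 ''input'' = s ''input''" using 3(2) frame1 by simp
      then show ?case using 3(1) input_layout(1)[of s, OF inp] by auto
    qed
  qed
  then show ?thesis
  proof (rule runs_weaken)
    show "1 + 10 + (Suc L * (1 + 7 + ?T) + 1 + 7) \<le> verify_time L"
      unfolding verify_time_def by (simp add: algebra_simps)
  qed (auto simp: less_Suc_eq_le)
qed

lemma runs_answer_prog:
  assumes "table_at (s ''output'') 2 xs"
  shows "runs answer_prog s 40
    (\<lambda>s'. output_of s' = (if s ''o'' 0 \<noteq> 0 then 1 # encode_table xs else [0]))"
proof (rule runs_loop_free)
  let ?s = "effect answer_prog s"
  show "output_of ?s = (if s ''o'' 0 \<noteq> 0 then 1 # encode_table xs else [0])"
  proof (cases "s ''o'' 0 = 0")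
    case True
    then show ?thesis by (simp add: answer_prog_def output_of_def)
  next
    case False
    have rest: "s ''output'' (Suc (Suc (Suc k))) = xs ! k" if "k < length xs" for k
      using assms that by (auto simp: table_at_def numeral_2_eq_2)
    show ?thesis
    proof (rule nth_equalityI)
      show len: "length (output_of ?s) = length (if s ''o'' 0 \<noteq> 0 then 1 # encode_table xs else [0])"
        using False assms by (simp add: answer_prog_def output_of_def encode_table_def table_at_def)
      fix k assume k: "k < length (output_of ?s)"
      have "output_of ?s ! k = ?s ''output'' (Suc k)"
        using k by (simp add: output_of_def del: upt_Suc)
      also have "\<dots> = (1 # encode_table xs) ! k"
      proof (cases k)
        case 0
        then show ?thesis using False by (simp add: answer_prog_def)
      next
        case k1: (Suc k1)
        show ?thesis
        proof (cases k1)
          case 0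
          then show ?thesis
            using False k1 assms by (simp add: answer_prog_def encode_table_def table_at_def numeral_2_eq_2)
        next
          case (Suc j)
          then have "j < length xs" using k len k1 False by (simp add: encode_table_def)
          then show ?thesis
            using False k1 Suc rest by (simp add: answer_prog_def encode_table_def)
        qed
      qed
      finally show "output_of ?s ! k = (if s ''o'' 0 \<noteq> 0 then 1 # encode_table xs else [0]) ! k"
        using False by simp
    qed
  qed
qed (simp_all add: answer_prog_def)

lemma solver_correct:
  "\<exists>t out. computes solver_prog (encode_instance ts b) t out \<and> t \<le> solver_time L \<and> correct_answer P B out"
proof -
  let ?s = "init_store (encode_instance ts b)"
  have "runs solver_prog ?s (1 + greedy_time L + (1 + verify_time L + 40)) (\<lambda>s. correct_answer P B (output_of s))"
    unfolding solver_prog_def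
  proof (rule runs_Seq[OF runs_greedy_prog], goal_cases)
    case 1
    show ?case by simp
  next
    case 2
    show ?case by (simp add: table_at_def init_store_def)
  next
    case (3 s1)
    then obtain xs where xs: "table_at (s1 ''output'') 2 xs" "partial_solution (Suc L) xs" "length xs \<le> L * L * L"
      by blast
    have inp: "s1 ''input'' = ?s ''input''" using 3(2) by simp
    have closed: "closed_table xs" and perm: "is_perm (table_fdds xs)"
      using xs(2) by (auto simp: partial_solution_def)
    show ?case
    proof (rule runs_Seq[OF runs_verify_prog[of s1, OF inp xs(1) closed xs(3)]], goal_cases)
      case (1 s2)
      have "s2 ''output'' = s1 ''output''" using 1(2) by simp
      then have out: "table_at (s2 ''output'') 2 xs" using xs(1) by simp
      have ok: "s2 ''o'' 0 \<noteq> 0 \<longleftrightarrow> solution (table_fdds xs)"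
        using 1(1) solution_iff_meets[OF perm] by simp
      show ?case
      proof (rule runs_weaken[OF runs_answer_prog[of s2, OF out]])
        fix s3 assume s3: "output_of s3 = (if s2 ''o'' 0 \<noteq> 0 then 1 # encode_table xs else [0])"
        show "correct_answer P B (output_of s3)"
        proof (cases "\<exists>X. solution X")
          case True
          then have "solution (table_fdds xs)" using complete_partial_solution[OF xs(2)] by metis
          then show ?thesis
            using ok s3 closed unfolding correct_answer_def solution_def
            by (auto simp: is_table_of_iff)
        next
          case False
          then have "\<not> solution (table_fdds xs)" by blast
          then show ?thesis
            using ok s3 False unfolding correct_answer_def solution_def by auto
        qed
      qed simp
    qed
  qed
  then show ?thesis
    unfolding runs_def computes_def solver_time_def by fastforce
qed

end

section \<open>The polynomial time bound\<close>

definition is_polynomial :: "(nat \<Rightarrow> nat) \<Rightarrow> bool" where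
  "is_polynomial f \<longleftrightarrow> (\<exists>p. f = poly p)"

lemma is_polynomial_const: "is_polynomial (\<lambda>n. c)"
  unfolding is_polynomial_def by (rule exI[of _ "[:c:]"]) auto

lemma is_polynomial_ident: "is_polynomial (\<lambda>n. n)"
  unfolding is_polynomial_def by (rule exI[of _ "[:0, 1:]"]) auto

lemma is_polynomial_add:
  assumes "is_polynomial f" "is_polynomial g"
  shows "is_polynomial (\<lambda>n. f n + g n)"
proof -
  obtain p q where "f = poly p" "g = poly q"
    using assms unfolding is_polynomial_def by blast
  then show ?thesis
    unfolding is_polynomial_def by (intro exI[of _ "p + q"]) auto
qed

lemma is_polynomial_mult:
  assumes "is_polynomial f" "is_polynomial g"
  shows "is_polynomial (\<lambda>n. f n * g n)"
proof -
  obtain p q where "f = poly p" "g = poly q"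
    using assms unfolding is_polynomial_def by blast
  then show ?thesis
    unfolding is_polynomial_def by (intro exI[of _ "p * q"]) auto
qed

lemma is_polynomial_solver_time: "is_polynomial solver_time"
  unfolding solver_time_def [abs_def] greedy_time_def verify_time_def extend_time_def probe_time_def
    eval_time_def step_time_def
  by (intro is_polynomial_add is_polynomial_mult is_polynomial_const is_polynomial_ident)

text \<open>Natural coefficients are never negative. Monotonicity matters because \<open>L\<close>
  is only bounded from above by the instance size.\<close>

lemma mono_poly_nat: "mono (poly (p :: nat poly))"
proof (rule monoI)
  show "poly p x \<le> poly p y" if "x \<le> y" for x y
    using that by (induction p) (auto intro: add_mono mult_le_mono)
qed

theorem theorem5:
  shows "\<exists>(solver :: program) (p :: nat poly).
    \<forall>(P :: fdds poly) (B :: fdds) ts b.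
      (\<forall>i. is_perm (coeff P i)) \<and> injective_on_perms P \<and> is_perm B \<and>
      is_table_of_poly ts P \<and> is_table_of b B \<longrightarrow>
      (\<exists>t out. computes solver (encode_instance ts b) t out \<and>
         t \<le> poly p (instance_size P B) \<and> correct_answer P B out)"
proof -
  obtain p where p: "solver_time = poly p"
    using is_polynomial_solver_time unfolding is_polynomial_def by blast
  show ?thesis
  \<comment> \<open>The running time is bounded by \<open>p\<close> at the input length, and
    \<open>[:2, 3:]\<close> is the linear bound \<open>L_le\<close> on that length.\<close>
  proof (intro exI[of _ solver_prog] exI[of _ "pcompose p [:2, 3:]"] allI impI, elim conjE)
    fix P B ts b
    assume "\<forall>i. is_perm (coeff P i)" "injective_on_perms P" "is_perm B"
      "is_table_of_poly ts P" "is_table_of b B"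
    then interpret perm_equation P B ts b by unfold_locales auto
    have "solver_time L \<le> poly (pcompose p [:2, 3:]) (instance_size P B)"
      using monoD[OF mono_poly_nat L_le, of p] by (simp add: p poly_pcompose algebra_simps)
    then show "\<exists>t out. computes solver_prog (encode_instance ts b) t out \<and>
        t \<le> poly (pcompose p [:2, 3:]) (instance_size P B) \<and> correct_answer P B out"
      using solver_correct by (meson order_trans)
  qed
qed

end
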